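(* Assume CH. Let $\kappa$ be a cardinal, let $\mathbb{I}=\langle \mathcal{I}_\xi:\xi<\kappa\rangle$ be a sequence of P--ideals in $[\omega_1]^{\le\aleph_0}$ with fixed generating sequences $\langle A^\xi_\alpha:\alpha<\omega_1\rangle$. Then $P(\mathbb{I})$ is totally proper.
   Context: $[\omega_1]^{\le\aleph_0}$ is the set of countable subsets of $\omega_1$; $A\subseteq^* B$ means $A\setminus B$ is finite. A P--ideal in $[\omega_1]^{\le\aleph_0}$ is a set $\mathcal{I}\subseteq[\omega_1]^{\le\aleph_0}$ closed under finite unions, subsets and finite modifications, such that for any $A_n\in\mathcal{I}$ ($n\in\omega$) there is $A\in\mathcal{I}$ with $A_n\subseteq^*A$ for all $n$. A generating sequence for $\mathcal{I}$ is $\langle A_\alpha:\alpha<\omega_1\rangle$ with $A_\alpha\subseteq\alpha$, $A_\alpha\subseteq^*A_\beta$ for $\alpha<\beta$, and every $A\in\mathcal{I}$ a subset of some $A_\alpha$. A promise is a function $f$ with $\mathrm{dom} f$ an uncountable subset of $\omega_1$ and $f(\alpha)$ a finite subset of $\alpha$. A condition in $P(\mathbb{I})$ is a pair $p=(a_p,\Phi_p)$ where $a_p$ is a function with countable domain $\subseteq\kappa\times\omega_1$ and range $\subseteq 2$, such that for each $\xi$ the set $[p]_\xi=\{\zeta:a_p(\xi,\zeta)=1\}\in\mathcal{I}_\xi$, and $\Phi_p$ is a countable set of pairs $(v,f)$, $v\subseteq\kappa$ finite, $f$ a promise. $q\le p$ iff $a_q\supseteq a_p$, $\Phi_q\supseteq\Phi_p$,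 and for each $(v,f)\in\Phi_p$ the set $Y(v,f,q,p)=\{\alpha\in\mathrm{dom} f:(\forall\xi\in v)\,[q]_\xi\setminus[p]_\xi\subseteq A^\xi_\alpha\setminus f(\alpha)\}$ is uncountable and $(v,f\restriction Y(v,f,q,p))\in\Phi_q$. A notion of forcing $P$ is totally proper if for every countable $N\prec H(\lambda)$ ($\lambda$ large regular) with $P\in N$ and every $p\in N\cap P$ there is a decreasing sequence $\langle p_n:n\in\omega\rangle\subseteq N\cap P$ with $p_0=p$, meeting every dense open subset of $P$ that belongs to $N$, which has a lower bound in $P$.
   Formalization: The members A^ξ_α of a generating sequence are also required to belong to the ideal I_ξ, which the definition above leaves unsaid; without this the claim fails, e.g. for I = the finite sets and A_α = α. *)

theory Defs
  imports "HOL-Library.Countable_Set"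
begin

unbundle cardinal_syntax

text \<open>The points of this type are the countable ordinals, so \<open>{..<\<alpha>}\<close> is the ordinal \<open>\<alpha>\<close>
  regarded as a set.\<close>

typedef omega1 = "Field (cardSuc natLeq)"
proof -
  have "infinite (Field (cardSuc natLeq))"
    using cardSuc_finite[OF natLeq_Card_order] by (simp add: Field_natLeq)
  then have "Field (cardSuc natLeq) \<noteq> {}" by force
  then show ?thesis by blast
qed

instantiation omega1 :: wellorder
begin

definition less_eq_omega1 :: "omega1 \<Rightarrow> omega1 \<Rightarrow> bool" where
  "\<alpha> \<le> \<beta> \<longleftrightarrow> (Rep_omega1 \<alpha>, Rep_omega1 \<beta>) \<in> cardSuc natLeq"

definition less_omega1 :: "omega1 \<Rightarrow> omega1 \<Rightarrow> bool" where
  "\<alpha> < (\<beta> :: omega1) \<longleftrightarrow> \<alpha> \<le> \<beta> \<and> \<alpha> \<noteq> \<beta>"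

instance
proof -
  have wo: "Well_order (cardSuc natLeq)"
    using cardSuc_Card_order[OF natLeq_Card_order] by (simp add: card_order_on_def)
  note props = wo[unfolded well_order_on_def linear_order_on_def partial_order_on_def
      preorder_on_def]
  have refl: "\<alpha> \<le> \<alpha>" for \<alpha> :: omega1
    using props Rep_omega1[of \<alpha>] by (simp add: less_eq_omega1_def refl_on_def)
  have trans: "\<alpha> \<le> \<gamma>" if "\<alpha> \<le> \<beta>" "\<beta> \<le> \<gamma>" for \<alpha> \<beta> \<gamma> :: omega1
    using props that unfolding less_eq_omega1_def by (meson transD)
  have antisym: "\<alpha> = \<beta>" if "\<alpha> \<le> \<beta>" "\<beta> \<le> \<alpha>" for \<alpha> \<beta> :: omega1
    using props that unfolding less_eq_omega1_def by (meson antisymD Rep_omega1_inject)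
  have total: "\<alpha> \<le> \<beta> \<or> \<beta> \<le> \<alpha>" for \<alpha> \<beta> :: omega1
  proof (cases "\<alpha> = \<beta>")
    case False
    then show ?thesis
      using props Rep_omega1[of \<alpha>] Rep_omega1[of \<beta>]
      unfolding less_eq_omega1_def total_on_def by (metis Rep_omega1_inject)
  qed (simp add: refl)
  have "wf (inv_image (cardSuc natLeq - Id) Rep_omega1)"
    using props by (intro wf_inv_image) simp
  moreover have "inv_image (cardSuc natLeq - Id) Rep_omega1 = {(\<alpha>, \<beta>). \<alpha> < \<beta>}"
    by (auto simp: inv_image_def less_omega1_def less_eq_omega1_def Rep_omega1_inject)
  ultimately have wf: "wf {(\<alpha>, \<beta> :: omega1). \<alpha> < \<beta>}" by simp
  show "OFCLASS(omega1, wellorder_class)"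
  proof
    fix \<alpha> \<beta> \<gamma> :: omega1 and Q :: "omega1 \<Rightarrow> bool"
    show "\<alpha> < \<beta> \<longleftrightarrow> \<alpha> \<le> \<beta> \<and> \<not> \<beta> \<le> \<alpha>"
      using antisym refl by (auto simp: less_omega1_def)
    show "\<alpha> \<le> \<alpha>" by (rule refl)
    show "\<alpha> \<le> \<gamma>" if "\<alpha> \<le> \<beta>" "\<beta> \<le> \<gamma>" using that by (rule trans)
    show "\<alpha> = \<beta>" if "\<alpha> \<le> \<beta>" "\<beta> \<le> \<alpha>" using that by (rule antisym)
    show "\<alpha> \<le> \<beta> \<or> \<beta> \<le> \<alpha>" by (rule total)
    show "Q \<gamma>" if step: "\<And>\<alpha>. (\<And>\<beta>. \<beta> < \<alpha> \<Longrightarrow> Q \<beta>) \<Longrightarrow> Q \<alpha>"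
      using wf by (induction \<gamma> rule: wf_induct_rule) (blast intro: step)
  qed
qed

end

lemma card_of_omega1: "|UNIV :: omega1 set| =o cardSuc natLeq"
proof -
  have "bij_betw Rep_omega1 UNIV (Field (cardSuc natLeq))"
    by (simp add: bij_betw_def inj_on_def Rep_omega1_inject type_definition.Rep_range[OF type_definition_omega1])
  then have "|UNIV :: omega1 set| =o |Field (cardSuc natLeq)|"
    using card_of_ordIso by blast
  then show ?thesis
    using card_of_Field_ordIso[OF cardSuc_Card_order[OF natLeq_Card_order]] ordIso_transitive
    by blast
qed

lemma countable_iff_natLeq: "countable A \<longleftrightarrow> |A| \<le>o natLeq"
proof -
  have "countable A \<longleftrightarrow> |A| \<le>o |UNIV :: nat set|"
    unfolding countable_def card_of_ordLeq[symmetric] by auto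
  then show ?thesis
    using card_of_nat ordLeq_ordIso_trans ordIso_symmetric by blast
qed

lemma uncountable_omega1: "uncountable (UNIV :: omega1 set)"
proof
  assume "countable (UNIV :: omega1 set)"
  then have "|UNIV :: omega1 set| \<le>o natLeq" by (simp add: countable_iff_natLeq)
  then have "cardSuc natLeq \<le>o natLeq"
    using card_of_omega1 ordIso_ordLeq_trans ordIso_symmetric by blast
  then show False
    using cardSuc_greater[OF natLeq_Card_order] not_ordLess_ordLeq by blast
qed

lemma countable_lessThan_omega1: "countable {..<\<alpha> :: omega1}"
proof -
  let ?r = "cardSuc natLeq"
  have "Rep_omega1 ` {..<\<alpha>} \<subseteq> underS ?r (Rep_omega1 \<alpha>)"
    by (auto simp: underS_def less_omega1_def less_eq_omega1_def Rep_omega1_inject)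
  moreover have "|underS ?r (Rep_omega1 \<alpha>)| <o ?r"
    by (rule card_of_underS[OF cardSuc_Card_order[OF natLeq_Card_order] Rep_omega1])
  ultimately have "|Rep_omega1 ` {..<\<alpha>}| <o ?r"
    by (rule ordLeq_ordLess_trans[OF card_of_mono1])
  then have "|Rep_omega1 ` {..<\<alpha>}| \<le>o natLeq"
    by (simp add: cardSuc_ordLeq_ordLess[OF natLeq_Card_order card_of_Card_order])
  then have "countable (Rep_omega1 ` {..<\<alpha>})" by (simp add: countable_iff_natLeq)
  then show ?thesis
    by (rule countable_image_inj_on) (simp add: inj_on_def Rep_omega1_inject)
qed

definition CH :: bool where
  "CH \<longleftrightarrow> |UNIV :: nat set set| =o cardSuc natLeq"

text \<open>The type \<open>'l hset\<close> consists of the well-founded sets all of whose hereditary members, and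
  which themselves, have at most \<open>|'l|\<close> elements. Such a set is represented by a well-founded tree
  with branches labelled by \<open>'l\<close>, where \<open>Node f\<close> denotes the set of what the trees in \<open>ran f\<close>
  denote, and trees are identified when they denote the same set.\<close>

datatype 'l tree = Node "'l \<rightharpoonup> 'l tree"

lemma tree_induct_ran: "(\<And>f. (\<And>s. s \<in> ran f \<Longrightarrow> Q s) \<Longrightarrow> Q (Node f)) \<Longrightarrow> Q t"
proof (induction t)
  case (Node f)
  have "Q s" if "s \<in> ran f" for s
  proof -
    from that obtain i where "f i = Some s" by (auto simp: ran_def)
    then show ?thesis using Node(1)[of "f i" s] Node(2) by (metis option.set_intros rangeI)
  qed
  then show ?case by (rule Node(2))
qed

inductive tree_eq :: "'l tree \<Rightarrow> 'l tree \<Rightarrow> bool" where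
  "\<lbrakk>\<forall>s\<in>ran f. \<exists>t\<in>ran g. tree_eq s t; \<forall>t\<in>ran g. \<exists>s\<in>ran f. tree_eq s t\<rbrakk>
    \<Longrightarrow> tree_eq (Node f) (Node g)"

lemma tree_eq_Node:
  "tree_eq (Node f) (Node g) \<longleftrightarrow>
     (\<forall>s\<in>ran f. \<exists>t\<in>ran g. tree_eq s t) \<and> (\<forall>t\<in>ran g. \<exists>s\<in>ran f. tree_eq s t)"
  by (subst tree_eq.simps) auto

lemma tree_eq_refl: "tree_eq s s"
  by (induction s rule: tree_induct_ran) (auto simp: tree_eq_Node)

lemma tree_eq_sym: "tree_eq s t \<Longrightarrow> tree_eq t s"
proof (induction rule: tree_eq.induct)
  case (1 f g)
  then show ?case by (intro tree_eq.intros) blast+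
qed

lemma tree_eq_trans: "tree_eq s t \<Longrightarrow> tree_eq t u \<Longrightarrow> tree_eq s u"
proof (induction arbitrary: u rule: tree_eq.induct)
  case (1 f g)
  obtain h where u: "u = Node h" by (cases u)
  have gh: "\<forall>t\<in>ran g. \<exists>u\<in>ran h. tree_eq t u" "\<forall>u\<in>ran h. \<exists>t\<in>ran g. tree_eq t u"
    using 1(3) by (auto simp: u tree_eq_Node)
  have "\<exists>u\<in>ran h. tree_eq s u" if "s \<in> ran f" for s
    using 1(1) gh(1) that by meson
  moreover have "\<exists>s\<in>ran f. tree_eq s u" if "u \<in> ran h" for u
    using 1(2) gh(2) that by meson
  ultimately show ?case by (simp add: u tree_eq_Node)
qed

quotient_type 'l hset = "'l tree" / tree_eq
  by (rule equivpI) (auto intro: reflpI sympI transpI tree_eq_refl tree_eq_sym tree_eq_trans)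

lift_definition hmem :: "'l hset \<Rightarrow> 'l hset \<Rightarrow> bool" is
  "\<lambda>s t. case t of Node f \<Rightarrow> \<exists>u\<in>ran f. tree_eq s u"
proof -
  fix s s' t t' :: "'l tree"
  assume s: "tree_eq s s'" and t: "tree_eq t t'"
  obtain f g where fg: "t = Node f" "t' = Node g" by (cases t, cases t')
  have "(\<exists>u\<in>ran f. tree_eq s u) \<longleftrightarrow> (\<exists>u\<in>ran g. tree_eq s' u)"
    using t s unfolding fg tree_eq_Node by (meson tree_eq_sym tree_eq_trans)
  then show "(case t of Node f \<Rightarrow> \<exists>u\<in>ran f. tree_eq s u) =
      (case t' of Node f \<Rightarrow> \<exists>u\<in>ran f. tree_eq s' u)"
    by (simp add: fg)
qed

definition elts :: "'l hset \<Rightarrow> 'l hset set" where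
  "elts x = {y. hmem y x}"

lemma hset_cases: obtains f where "x = abs_hset (Node f)"
  using Quotient3_abs_rep[OF Quotient3_hset, of x] by (metis tree.exhaust)

lemma elts_abs_Node: "elts (abs_hset (Node f)) = abs_hset ` ran f"
proof -
  have "hmem y (abs_hset (Node f)) \<longleftrightarrow> (\<exists>u\<in>ran f. y = abs_hset u)" for y
    by (rule hset_cases[of y]) (simp add: hmem.abs_eq hset.abs_eq_iff)
  then show ?thesis by (auto simp: elts_def)
qed

lemma hset_ext: "elts x = elts y \<Longrightarrow> x = y"
proof -
  assume elts: "elts x = elts y"
  obtain f g where xy: "x = abs_hset (Node f)" "y = abs_hset (Node g)"
    by (metis hset_cases)
  have eq: "abs_hset ` ran f = abs_hset ` ran g"
    using elts by (simp add: xy elts_abs_Node)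
  have "\<exists>t\<in>ran g. tree_eq s t" if "s \<in> ran f" for s
    using eq that by (metis (no_types) hset.abs_eq_iff image_iff)
  moreover have "\<exists>s\<in>ran f. tree_eq s t" if "t \<in> ran g" for t
    using eq that by (metis (no_types) hset.abs_eq_iff image_iff)
  ultimately show ?thesis by (simp add: xy hset.abs_eq_iff tree_eq_Node)
qed

lemma wfP_hmem: "wfP hmem"
proof (rule wfpUNIVI)
  fix Q :: "'l hset \<Rightarrow> bool" and x
  assume step: "\<forall>x. (\<forall>y. hmem y x \<longrightarrow> Q y) \<longrightarrow> Q x"
  have "Q (abs_hset t)" for t
  proof (induction t rule: tree_induct_ran)
    case (1 f)
    have "Q y" if "hmem y (abs_hset (Node f))" for y
    proof -
      have "y \<in> elts (abs_hset (Node f))" using that by (simp add: elts_def)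
      then show ?thesis using 1 by (auto simp: elts_abs_Node)
    qed
    then show ?case using step by blast
  qed
  then show "Q x" using hset_cases[of x] by metis
qed

lemma card_of_elts: "|elts x| \<le>o |UNIV :: 'l set|" for x :: "'l hset"
proof -
  obtain f where x: "x = abs_hset (Node f)" by (rule hset_cases)
  have "ran f \<subseteq> (the \<circ> f) ` UNIV" by (auto simp: ran_def) (metis option.sel rangeI)
  then have "elts x \<subseteq> (abs_hset \<circ> (the \<circ> f)) ` UNIV"
    by (auto simp: x elts_abs_Node)
  then show ?thesis
    by (rule surj_imp_ordLeq)
qed

lemma ex_elts_eq:
  fixes A :: "'l hset set"
  assumes "|A| \<le>o |UNIV :: 'l set|"
  shows "\<exists>x. elts x = A"
proof -
  obtain h :: "'l hset \<Rightarrow> 'l" where h: "inj_on h A"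
    using assms card_of_ordLeq[of A "UNIV :: 'l set"] by auto
  define f where "f i = (if i \<in> h ` A then Some (rep_hset (inv_into A h i)) else None)" for i
  have "ran f = rep_hset ` A"
  proof (intro subset_antisym subsetI)
    fix t assume "t \<in> ran f"
    then show "t \<in> rep_hset ` A" using h by (auto simp: f_def ran_def split: if_splits)
  next
    fix t assume "t \<in> rep_hset ` A"
    then obtain a where "a \<in> A" "t = rep_hset a" by blast
    then have "f (h a) = Some t" using h by (simp add: f_def)
    then show "t \<in> ran f" by (rule ranI)
  qed
  then have "elts (abs_hset (Node f)) = A"
    by (simp add: elts_abs_Node image_image Quotient3_abs_rep[OF Quotient3_hset])
  then show ?thesis ..
qed

definition HSet :: "'l hset set \<Rightarrow> 'l hset" where
  "HSet A = (THE x. elts x = A)"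

lemma elts_HSet: "|A| \<le>o |UNIV :: 'l set| \<Longrightarrow> elts (HSet A) = A" for A :: "'l hset set"
  unfolding HSet_def using ex_elts_eq[of A] hset_ext by (metis (mono_tags, lifting) theI')

text \<open>Kuratowski pairs; meaningful as soon as \<open>'l\<close> has at least two elements, in particular
  whenever \<open>'l\<close> carries an infinite cardinal.\<close>

definition hpair :: "'l hset \<Rightarrow> 'l hset \<Rightarrow> 'l hset" where
  "hpair x y = HSet {HSet {x}, HSet {x, y}}"

definition trcl :: "'l hset \<Rightarrow> 'l hset set" where
  "trcl x = {y. hmem\<^sup>+\<^sup>+ y x}"

text \<open>For a cardinal \<open>\<lambda>\<close> on (a subset of) \<open>'l\<close> no set of hereditary cardinality below \<open>\<lambda>\<close> is
  missing from \<open>'l hset\<close>, so this is all of \<open>H(\<lambda>)\<close>.\<close>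

definition H_of :: "'l rel \<Rightarrow> 'l hset set" where
  "H_of lam = {x. |trcl x| <o lam}"

definition uncountable_regular :: "'l rel \<Rightarrow> bool" where
  "uncountable_regular lam \<longleftrightarrow> Card_order lam \<and> natLeq <o lam \<and> regularCard lam"

lemma trcl_eq: "trcl x = elts x \<union> (\<Union>y\<in>elts x. trcl y)"
proof -
  have "hmem\<^sup>+\<^sup>+ z x \<longleftrightarrow> hmem z x \<or> (\<exists>y. hmem y x \<and> hmem\<^sup>+\<^sup>+ z y)" for z
    by (metis tranclp.simps)
  then show ?thesis unfolding trcl_def elts_def by blast
qed

lemma elts_in_H:
  assumes "x \<in> H_of lam" and "y \<in> elts x"
  shows "y \<in> H_of lam"
proof -
  have "trcl y \<subseteq> trcl x" using assms(2) trcl_eq[of x] by blast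
  then show ?thesis
    using assms(1) unfolding H_of_def by (auto intro: ordLeq_ordLess_trans[OF card_of_mono1])
qed

lemma H_closed:
  fixes lam :: "'l rel"
  assumes lam: "uncountable_regular lam" and A: "A \<subseteq> H_of lam" "|A| <o lam"
  shows "\<exists>x\<in>H_of lam. elts x = A"
proof -
  have card: "Card_order lam" and reg: "regularCard lam" and unc: "natLeq <o lam"
    using lam by (auto simp: uncountable_regular_def)
  have inf: "\<not> finite (Field lam)"
    using unc card
    by (meson infinite_iff_natLeq_ordLeq card_of_Field_ordIso ordIso_symmetric
        ordLeq_ordIso_trans ordLess_imp_ordLeq)
  have "lam \<le>o |UNIV :: 'l set|"
    using card_of_Field_ordIso[OF card] card_of_mono1[OF subset_UNIV, of "Field lam"]
      ordIso_ordLeq_trans ordIso_symmetric by blast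
  then have "|A| \<le>o |UNIV :: 'l set|"
    using A(2) ordLess_imp_ordLeq ordLeq_transitive by blast
  then obtain x where x: "elts x = A" using ex_elts_eq by blast
  have "|\<Union>y\<in>A. trcl y| <o lam"
    using regularCard_stable[OF card inf reg] A stable_UNION[of lam A trcl]
    by (auto simp: H_of_def)
  then have "|A \<union> (\<Union>y\<in>A. trcl y)| <o lam"
    using A(2) inf card card_of_Un_ordLess_infinite_Field by blast
  then have "|trcl x| <o lam" by (simp add: x trcl_eq[of x])
  then show ?thesis using x by (auto simp: H_of_def)
qed

text \<open>First-order formulas of the language of set theory, with variables named by natural
  numbers.\<close>

datatype fm = Mem nat nat | Eq nat nat | Neg fm | Conj fm fm | Ex nat fm

primrec sat :: "'l hset set \<Rightarrow> fm \<Rightarrow> (nat \<Rightarrow> 'l hset) \<Rightarrow> bool" where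
  "sat M (Mem i j) e \<longleftrightarrow> hmem (e i) (e j)"
| "sat M (Eq i j) e \<longleftrightarrow> e i = e j"
| "sat M (Neg \<phi>) e \<longleftrightarrow> \<not> sat M \<phi> e"
| "sat M (Conj \<phi> \<psi>) e \<longleftrightarrow> sat M \<phi> e \<and> sat M \<psi> e"
| "sat M (Ex i \<phi>) e \<longleftrightarrow> (\<exists>x\<in>M. sat M \<phi> (e(i := x)))"

definition elementary :: "'l hset set \<Rightarrow> 'l hset set \<Rightarrow> bool"  (infix \<open>\<prec>\<close> 50) where
  "N \<prec> M \<longleftrightarrow> N \<noteq> {} \<and> N \<subseteq> M \<and> (\<forall>\<phi> e. range e \<subseteq> N \<longrightarrow> (sat N \<phi> e \<longleftrightarrow> sat M \<phi> e))"

definition dense_open :: "'p set \<Rightarrow> ('p \<Rightarrow> 'p \<Rightarrow> bool) \<Rightarrow> 'p set \<Rightarrow> bool" where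
  "dense_open P le D \<longleftrightarrow> D \<subseteq> P
     \<and> (\<forall>p\<in>P. \<exists>d\<in>D. le d p)
     \<and> (\<forall>d\<in>D. \<forall>p\<in>P. le p d \<longrightarrow> p \<in> D)"

text \<open>A notion of forcing is given by a set \<open>P\<close> and a relation \<open>le\<close> over an arbitrary type, so to
  speak of its membership in \<open>N\<close> it has to be copied into the universe of sets: \<open>c\<close> replaces each
  condition by a set, and \<open>in_model c P le N\<close> says that the resulting ordered pair of underlying
  set and order relation belongs to \<open>N\<close>.\<close>

definition in_model ::
    "('p \<Rightarrow> 'l hset) \<Rightarrow> 'p set \<Rightarrow> ('p \<Rightarrow> 'p \<Rightarrow> bool) \<Rightarrow> 'l hset set \<Rightarrow> bool" where
  "in_model c P le N \<longleftrightarrow> inj_on c P \<and>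
     (\<exists>P' R'. elts P' = c ` P \<and>
              elts R' = {hpair (c p) (c q) | p q. p \<in> P \<and> q \<in> P \<and> le p q} \<and>
              hpair P' R' \<in> N)"

text \<open>Total properness with respect to the regular cardinals \<open>\<lambda>\<close> carried by the type \<open>'l\<close>; to get it
  for all \<open>\<lambda>\<close>, keep \<open>'l\<close> a type variable. A regular cardinal is ``large'' if it exceeds \<open>2 ^ |P|\<close>.
  The copy \<open>c\<close> is arbitrary, so no particular set-theoretic coding of the conditions is singled
  out.\<close>

definition totally_proper :: "'l itself \<Rightarrow> 'p set \<Rightarrow> ('p \<Rightarrow> 'p \<Rightarrow> bool) \<Rightarrow> bool" where
  "totally_proper TYPE('l) P le \<longleftrightarrow>
     (\<forall>(lam :: 'l rel) N c.
        uncountable_regular lam \<longrightarrow> |Pow P| <o lam \<longrightarrow>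
        countable N \<longrightarrow> N \<prec> H_of lam \<longrightarrow> in_model c P le N \<longrightarrow>
        (\<forall>p\<in>P. c p \<in> N \<longrightarrow>
           (\<exists>s :: nat \<Rightarrow> 'p.
              s 0 = p \<and>
              (\<forall>n. s n \<in> P \<and> c (s n) \<in> N \<and> le (s (Suc n)) (s n)) \<and>
              (\<forall>D d. dense_open P le D \<and> elts d = c ` D \<and> d \<in> N \<longrightarrow> (\<exists>n. s n \<in> D)) \<and>
              (\<exists>q\<in>P. \<forall>n. le q (s n)))))"

definition almost_subset :: "'a set \<Rightarrow> 'a set \<Rightarrow> bool"  (infix \<open>\<subseteq>*\<close> 50) where
  "A \<subseteq>* B \<longleftrightarrow> finite (A - B)"

definition P_ideal :: "omega1 set set \<Rightarrow> bool" where
  "P_ideal I \<longleftrightarrow>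
     (\<forall>A\<in>I. countable A) \<and>
     (\<forall>A\<in>I. \<forall>B\<in>I. A \<union> B \<in> I) \<and>
     (\<forall>A\<in>I. \<forall>B. B \<subseteq> A \<longrightarrow> B \<in> I) \<and>
     (\<forall>A\<in>I. \<forall>B. finite (A - B) \<and> finite (B - A) \<longrightarrow> B \<in> I) \<and>
     (\<forall>A :: nat \<Rightarrow> omega1 set. (\<forall>n. A n \<in> I) \<longrightarrow> (\<exists>B\<in>I. \<forall>n. A n \<subseteq>* B))"

text \<open>A generating sequence consists of members of the ideal. Without the first conjunct
  \<open>\<lambda>\<alpha>. {..<\<alpha>}\<close> would generate every ideal.\<close>

definition generating_sequence :: "(omega1 \<Rightarrow> omega1 set) \<Rightarrow> omega1 set set \<Rightarrow> bool" where
  "generating_sequence A I \<longleftrightarrow>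
     (\<forall>\<alpha>. A \<alpha> \<in> I) \<and>
     (\<forall>\<alpha>. A \<alpha> \<subseteq> {..<\<alpha>}) \<and>
     (\<forall>\<alpha> \<beta>. \<alpha> < \<beta> \<longrightarrow> A \<alpha> \<subseteq>* A \<beta>) \<and>
     (\<forall>B\<in>I. \<exists>\<alpha>. B \<subseteq> A \<alpha>)"

definition promise :: "(omega1 \<rightharpoonup> omega1 set) \<Rightarrow> bool" where
  "promise f \<longleftrightarrow> uncountable (dom f) \<and> (\<forall>\<alpha>\<in>dom f. finite (the (f \<alpha>)) \<and> the (f \<alpha>) \<subseteq> {..<\<alpha>})"

text \<open>A condition is a pair \<open>(a, \<Phi>)\<close>; the values \<open>0\<close> and \<open>1\<close> of \<open>a\<close> are rendered as \<open>False\<close> and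
  \<open>True\<close>.\<close>

type_synonym 'k cond =
  "('k \<times> omega1 \<rightharpoonup> bool) \<times> ('k set \<times> (omega1 \<rightharpoonup> omega1 set)) set"

definition ones :: "'k cond \<Rightarrow> 'k \<Rightarrow> omega1 set" where
  "ones p \<xi> = {\<zeta>. fst p (\<xi>, \<zeta>) = Some True}"

text \<open>A cardinal \<open>\<kappa>\<close> is a cardinal order; its elements, the ordinals below \<open>\<kappa>\<close>, are the points of
  its field.\<close>

definition P_forcing :: "'k rel \<Rightarrow> ('k \<Rightarrow> omega1 set set) \<Rightarrow> 'k cond set" where
  "P_forcing kap I = {(a, \<Phi>).
     countable (dom a) \<and> dom a \<subseteq> Field kap \<times> UNIV \<and>
     (\<forall>\<xi>\<in>Field kap. ones (a, \<Phi>) \<xi> \<in> I \<xi>) \<and>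
     countable \<Phi> \<and>
     (\<forall>(v, f)\<in>\<Phi>. finite v \<and> v \<subseteq> Field kap \<and> promise f)}"

definition Y_set :: "('k \<Rightarrow> omega1 \<Rightarrow> omega1 set) \<Rightarrow> 'k set \<Rightarrow> (omega1 \<rightharpoonup> omega1 set)
    \<Rightarrow> 'k cond \<Rightarrow> 'k cond \<Rightarrow> omega1 set" where
  "Y_set A v f q p = {\<alpha>\<in>dom f. \<forall>\<xi>\<in>v. ones q \<xi> - ones p \<xi> \<subseteq> A \<xi> \<alpha> - the (f \<alpha>)}"

definition P_le :: "('k \<Rightarrow> omega1 \<Rightarrow> omega1 set) \<Rightarrow> 'k cond \<Rightarrow> 'k cond \<Rightarrow> bool" where
  "P_le A q p \<longleftrightarrow>
     fst p \<subseteq>\<^sub>m fst q \<and> snd p \<subseteq> snd q \<and>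
     (\<forall>(v, f)\<in>snd p. uncountable (Y_set A v f q p) \<and> (v, f |` Y_set A v f q p) \<in> snd q)"

lemma restrict_map_dom: "f |` dom f = f"
proof
  show "(f |` dom f) x = f x" for x by (cases "f x") (auto simp: restrict_map_def)
qed

lemma P_le_refl: "p \<in> P_forcing kap I \<Longrightarrow> P_le A p p"
  by (auto simp: P_le_def P_forcing_def Y_set_def promise_def restrict_map_dom)

lemma ones_mono: "fst p \<subseteq>\<^sub>m fst q \<Longrightarrow> ones p \<xi> \<subseteq> ones q \<xi>"
  by (force simp: ones_def map_le_def)

lemma P_le_trans:
  assumes rq: "P_le A r q" and qp: "P_le A q p"
  shows "P_le A r p"
proof -
  have maps: "fst p \<subseteq>\<^sub>m fst q" "fst q \<subseteq>\<^sub>m fst r" using rq qp by (auto simp: P_le_def)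
  have union: "ones r \<xi> - ones p \<xi> = (ones r \<xi> - ones q \<xi>) \<union> (ones q \<xi> - ones p \<xi>)" for \<xi>
    using maps[THEN ones_mono, of \<xi>] by blast
  have sub: "Y_set A v f r p \<subseteq> Y_set A v f q p" for v f
    unfolding Y_set_def union by blast
  have dom: "dom (f |` Y_set A v f q p) = Y_set A v f q p" for v f
    by (auto simp: Y_set_def)
  have "\<alpha> \<in> Y_set A v (f |` Y_set A v f q p) r q \<longleftrightarrow> \<alpha> \<in> Y_set A v f r p" for v f \<alpha>
  proof (cases "\<alpha> \<in> Y_set A v f q p")
    case True
    then show ?thesis
      unfolding Y_set_def[of A v _ r] dom mem_Collect_eq union Un_subset_iff
      by (auto simp: Y_set_def)
  next
    case False
    then show ?thesis
      using sub[of v f] unfolding Y_set_def[of A v "f |` _" r] dom by blast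
  qed
  then have eq: "Y_set A v (f |` Y_set A v f q p) r q = Y_set A v f r p" for v f by blast
  have "uncountable (Y_set A v f r p) \<and> (v, f |` Y_set A v f r p) \<in> snd r"
    if "(v, f) \<in> snd p" for v f
  proof -
    have "(v, f |` Y_set A v f q p) \<in> snd q" using qp that by (auto simp: P_le_def)
    then have "uncountable (Y_set A v (f |` Y_set A v f q p) r q) \<and>
        (v, (f |` Y_set A v f q p) |` Y_set A v (f |` Y_set A v f q p) r q) \<in> snd r"
      using rq unfolding P_le_def by blast
    moreover have "Y_set A v f q p \<inter> Y_set A v f r p = Y_set A v f r p"
      using sub[of v f] by blast
    ultimately show ?thesis by (simp add: eq)
  qed
  moreover have "fst p \<subseteq>\<^sub>m fst r" using maps by (rule map_le_trans)
  moreover have "snd p \<subseteq> snd r" using rq qp by (auto simp: P_le_def)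
  ultimately show ?thesis unfolding P_le_def by blast
qed

end

theory Submission
  imports Defs
begin

text \<open>
  Fix a condition \<open>p\<close>, a dense set \<open>D\<close> and a finite set \<open>w\<close> of coordinates. For all but countably many
  \<open>\<alpha>\<close> it is possible, for every finite \<open>F\<close>, to extend \<open>p\<close> into \<open>D\<close> adding on \<open>w\<close> only points of
  \<open>A \<xi> \<alpha> - F\<close>: otherwise the offending finite sets \<open>F\<close> form a promise, which can be added to \<open>p\<close> and
  which no extension in \<open>D\<close> can respect. For a single such \<open>\<alpha>\<close> only countably many \<open>F\<close> matter,
  and \<open>A \<xi> \<alpha> \<subseteq>* A \<xi> \<delta>\<close> transfers the extensions to every \<open>\<delta> > \<alpha>\<close> at the cost of enlarging \<open>F\<close>. Hence
  countably many conditions in \<open>D\<close> suffice for all large \<open>\<delta>\<close> at once. A countable set \<open>M\<close> closed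
  under choosing these conditions therefore contains generic sequences that on each coordinate
  eventually add only points of \<open>A \<xi> \<delta>\<close>, for one large \<open>\<delta>\<close>, and this gives the lower bound. A
  promise \<open>f\<close> survives since uncountably many \<open>\<alpha> \<in> dom f\<close> share the finite sets
  \<open>A \<xi> \<delta> - (A \<xi> \<alpha> - f \<alpha>)\<close>, which are then avoided.

  An elementary submodel \<open>N\<close> contains an isomorphic copy of the forcing only, not \<open>I\<close> and \<open>A\<close>. The
  existence of a function \<open>G\<close> all of whose countable closed sets \<open>M\<close> have the above property is,
  however, expressible in terms of the partial order, so some such \<open>G\<close> belongs to \<open>N\<close>, and \<open>N\<close> is
  closed under it.
\<close>

section \<open>Generic sequences in the forcing\<close>

lemma countable_bounded_omega1:
  assumes "countable (C :: omega1 set)"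
  shows "\<exists>\<gamma>. \<forall>x\<in>C. x < \<gamma>"
proof (rule ccontr)
  assume "\<not> ?thesis"
  then have "\<And>\<gamma>. \<exists>x\<in>C. \<gamma> \<le> x" by (meson not_le)
  then have "UNIV \<subseteq> (\<Union>x\<in>C. insert x {..<x})" by (force simp: le_less)
  moreover have "countable (\<Union>x\<in>C. insert x {..<x})"
    using assms by (intro countable_UN countable_insert countable_lessThan_omega1) auto
  ultimately show False using uncountable_omega1 countable_subset by blast
qed

lemma uncountable_fiber:
  assumes "uncountable Y" "countable (g ` Y)"
  shows "\<exists>b. uncountable {x \<in> Y. g x = b}"
proof (rule ccontr)
  assume "\<not> ?thesis"
  then have "countable (\<Union>b\<in>g ` Y. {x \<in> Y. g x = b})"
    using assms(2) by (intro countable_UN) auto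
  moreover have "(\<Union>b\<in>g ` Y. {x \<in> Y. g x = b}) = Y" by blast
  ultimately show False using assms(1) by simp
qed

text \<open>Stage \<open>Suc n\<close> meets the set indexed by the first component of
  \<open>prod_decode n\<close>. An index \<open>i\<close> recurs at every
  \<open>prod_encode (i, m)\<close>, which is at least \<open>m\<close>, so each set is met
  arbitrarily late.\<close>

lemma generic_sequence:
  fixes le :: "'t \<Rightarrow> 't \<Rightarrow> bool" and E :: "nat \<Rightarrow> 't set"
  assumes "t \<in> T" and "\<And>i x. x \<in> T \<Longrightarrow> \<exists>y\<in>T. le y x \<and> y \<in> E i"
  obtains s where "s 0 = t" "\<And>n. s n \<in> T" "\<And>n. le (s (Suc n)) (s n)"
    "\<And>i m. \<exists>n\<ge>m. s n \<in> E i"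
proof -
  have "\<exists>s. \<forall>n. (s n \<in> T \<and> (n = 0 \<longrightarrow> s n = t)) \<and>
      (le (s (Suc n)) (s n) \<and> s (Suc n) \<in> E (fst (prod_decode n)))"
    by (rule dependent_nat_choice) (use assms in auto)
  then obtain s where s: "\<And>n. s n \<in> T" "s 0 = t" "\<And>n. le (s (Suc n)) (s n)"
      "\<And>n. s (Suc n) \<in> E (fst (prod_decode n))" by metis
  have "\<exists>n\<ge>m. s n \<in> E i" for i m
    using s(4)[of "prod_encode (i, m)"] le_prod_encode_2[of m i]
    by (intro exI[of _ "Suc (prod_encode (i, m))"]) auto
  with s that show thesis by blast
qed

section \<open>Closing functions and the support of a condition\<close>

definition dense_in :: "'p set \<Rightarrow> ('p \<Rightarrow> 'p \<Rightarrow> bool) \<Rightarrow> 'p set \<Rightarrow> bool" where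
  "dense_in P le D \<longleftrightarrow> D \<subseteq> P \<and> (\<forall>p\<in>P. \<exists>d\<in>D. le d p)"

text \<open>A directed set replaces a descending sequence, because directedness can be expressed
  without coding sequences. A sequence is recovered from it at the very end.\<close>

definition strongly_generic :: "'p set \<Rightarrow> ('p \<Rightarrow> 'p \<Rightarrow> bool) \<Rightarrow> 'p set \<Rightarrow> 'p set set \<Rightarrow> 'p set \<Rightarrow> bool" where
  "strongly_generic P le M \<D> S \<longleftrightarrow> S \<subseteq> M \<and> (\<forall>x\<in>S. \<forall>y\<in>S. \<exists>z\<in>S. le z x \<and> le z y) \<and>
     (\<forall>D\<in>\<D>. S \<inter> D \<noteq> {}) \<and> (\<exists>q\<in>P. \<forall>x\<in>S. le q x)"

text \<open>The index \<open>k\<close> enumerates a countable supply of extensions of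
  \<open>p\<close> in \<open>D\<close>. In the application \<open>M\<close> and \<open>\<D>\<close>
  consist of the conditions and dense sets coded in one countable set.\<close>

definition generically_closing ::
    "'p set \<Rightarrow> ('p \<Rightarrow> 'p \<Rightarrow> bool) \<Rightarrow> ('p \<Rightarrow> 'p set \<Rightarrow> nat \<Rightarrow> 'p) \<Rightarrow> bool" where
  "generically_closing P le G \<longleftrightarrow> (\<forall>p\<in>P. \<forall>D k. dense_in P le D \<longrightarrow> G p D k \<in> P) \<and>
    (\<forall>M \<D>. countable M \<and> M \<subseteq> P \<and> countable \<D> \<and>
      (\<forall>D\<in>\<D>. dense_in P le D \<and> (\<forall>p\<in>M. \<forall>k. G p D k \<in> M)) \<longrightarrow>
      (\<forall>p\<in>M. \<exists>S. p \<in> S \<and> strongly_generic P le M \<D> S))"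

text \<open>Coordinates of promises are included so that a finite part of the support can cover a
  whole \<open>v\<close>; the set is still countable for every condition.\<close>

definition supp :: "'k cond \<Rightarrow> 'k set" where
  "supp p = fst ` dom (fst p) \<union> (\<Union>(v, f)\<in>snd p. v)"

lemma ones_subset_supp: "\<zeta> \<in> ones p \<xi> \<Longrightarrow> \<xi> \<in> supp p"
  by (force simp: ones_def supp_def)

lemma supp_mono: "P_le A q p \<Longrightarrow> supp p \<subseteq> supp q"
proof -
  assume "P_le A q p"
  then have "dom (fst p) \<subseteq> dom (fst q)" "snd p \<subseteq> snd q"
    by (simp_all add: P_le_def map_le_implies_dom_le)
  then show ?thesis unfolding supp_def by blast
qed

lemma Y_set_subset_dom: "Y_set A v f q p \<subseteq> dom f"
  by (auto simp: Y_set_def)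

section \<open>Extensions into a dense set with restricted new points\<close>

locale P_ideal_sequence =
  fixes kap :: "'k rel"
    and I :: "'k \<Rightarrow> omega1 set set"
    and A :: "'k \<Rightarrow> omega1 \<Rightarrow> omega1 set"
  assumes ideal: "\<And>\<xi>. \<xi> \<in> Field kap \<Longrightarrow> P_ideal (I \<xi>)"
    and gen: "\<And>\<xi>. \<xi> \<in> Field kap \<Longrightarrow> generating_sequence (A \<xi>) (I \<xi>)"
begin

abbreviation "P \<equiv> P_forcing kap I"
abbreviation le (infix \<open>\<preceq>\<close> 50) where "le \<equiv> P_le A"

lemma A_in: "\<xi> \<in> Field kap \<Longrightarrow> A \<xi> \<alpha> \<in> I \<xi>"
  and A_below: "\<xi> \<in> Field kap \<Longrightarrow> A \<xi> \<alpha> \<subseteq> {..<\<alpha>}"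
  and A_almost: "\<xi> \<in> Field kap \<Longrightarrow> \<alpha> < \<beta> \<Longrightarrow> finite (A \<xi> \<alpha> - A \<xi> \<beta>)"
  using gen unfolding generating_sequence_def almost_subset_def by simp_all

lemma ideal_Un: "\<xi> \<in> Field kap \<Longrightarrow> B \<in> I \<xi> \<Longrightarrow> C \<in> I \<xi> \<Longrightarrow> B \<union> C \<in> I \<xi>"
  and ideal_subset: "\<xi> \<in> Field kap \<Longrightarrow> B \<in> I \<xi> \<Longrightarrow> C \<subseteq> B \<Longrightarrow> C \<in> I \<xi>"
  using ideal unfolding P_ideal_def by meson+

lemma P_iff: "p \<in> P \<longleftrightarrow> countable (dom (fst p)) \<and> dom (fst p) \<subseteq> Field kap \<times> UNIV \<and>
    (\<forall>\<xi>\<in>Field kap. ones p \<xi> \<in> I \<xi>) \<and> countable (snd p) \<and>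
    (\<forall>v f. (v, f) \<in> snd p \<longrightarrow> finite v \<and> v \<subseteq> Field kap \<and> promise f)"
  by (cases p) (simp add: P_forcing_def Ball_def)

lemma ones_in: "p \<in> P \<Longrightarrow> \<xi> \<in> Field kap \<Longrightarrow> ones p \<xi> \<in> I \<xi>"
  by (simp add: P_iff)

lemma supp_countable: "p \<in> P \<Longrightarrow> countable (supp p)"
  and supp_subset_Field: "p \<in> P \<Longrightarrow> supp p \<subseteq> Field kap"
proof -
  assume "p \<in> P"
  then have p: "countable (dom (fst p))" "dom (fst p) \<subseteq> Field kap \<times> UNIV" "countable (snd p)"
    "\<forall>(v, f)\<in>snd p. finite v \<and> v \<subseteq> Field kap"
    unfolding P_iff by simp_all blast
  have "countable (\<Union>(v, f)\<in>snd p. v)"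
    using p(3,4) by (intro countable_UN) (auto intro: countable_finite)
  then show "countable (supp p)" using p(1) by (simp add: supp_def)
  show "supp p \<subseteq> Field kap" using p(2,4) by (fastforce simp: supp_def)
qed

definition adds_within :: "'k cond \<Rightarrow> 'k set \<Rightarrow> omega1 \<Rightarrow> omega1 set \<Rightarrow> 'k cond \<Rightarrow> bool" where
  "adds_within p w \<delta> F q \<longleftrightarrow> q \<preceq> p \<and> (\<forall>\<xi>\<in>w. ones q \<xi> - ones p \<xi> \<subseteq> A \<xi> \<delta> - F)"

lemma adds_within_mono:
  "adds_within p w \<delta> F q \<Longrightarrow> (\<And>\<xi>. \<xi> \<in> w \<Longrightarrow> A \<xi> \<delta> - F \<subseteq> A \<xi> \<delta>' - F') \<Longrightarrow> adds_within p w \<delta>' F' q"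
  unfolding adds_within_def by blast

text \<open>If uncountably many \<open>\<alpha>\<close> were bad, a choice of offending sets
  \<open>F \<alpha>\<close> would give a promise \<open>f\<close>. For an extension \<open>q\<close>
  in \<open>D\<close> of \<open>p\<close> with \<open>(w, f)\<close> added, any
  \<open>\<alpha>\<close> in the uncountable set \<open>Y_set A w f q p'\<close> contradicts the
  choice of \<open>F \<alpha>\<close>.\<close>

lemma countable_bad:
  assumes p: "p \<in> P" and D: "dense_in P le D" and w: "finite w" "w \<subseteq> Field kap"
  shows "countable {\<alpha>. \<exists>F. finite F \<and> \<not> (\<exists>q\<in>D. adds_within p w \<alpha> F q)}" (is "countable ?B")
proof (rule ccontr)
  assume unc: "\<not> countable ?B"
  have "\<forall>\<alpha>\<in>?B. \<exists>F. finite F \<and> \<not> (\<exists>q\<in>D. adds_within p w \<alpha> F q)" by simp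
  from bchoice[OF this] obtain F where F: "\<And>\<alpha>. \<alpha> \<in> ?B \<Longrightarrow> finite (F \<alpha>)"
    "\<And>\<alpha> q. \<alpha> \<in> ?B \<Longrightarrow> q \<in> D \<Longrightarrow> \<not> adds_within p w \<alpha> (F \<alpha>) q"
    by blast
  define B where "B = ?B"
  note unc = unc[folded B_def] and F = F[folded B_def]
  \<comment> \<open>Values of a promise must lie below \<open>\<alpha>\<close>. The truncation loses
    nothing, as \<open>A \<xi> \<alpha> \<subseteq> {..<\<alpha>}\<close>.\<close>
  define f where "f \<alpha> = (if \<alpha> \<in> B then Some (F \<alpha> \<inter> {..<\<alpha>}) else None)" for \<alpha>
  have domf: "dom f = B" by (auto simp: f_def split: if_splits)
  have f: "promise f" using unc F(1) unfolding promise_def domf by (auto simp: f_def)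
  define p' where "p' = (fst p, insert (w, f) (snd p))"
  have ones': "ones p' = ones p" by (auto simp: p'_def ones_def)
  have p': "p' \<in> P" using p f w unfolding P_iff ones' by (simp add: p'_def)
  \<comment> \<open>No point is added, so each \<open>Y_set\<close> from \<open>p\<close> to
    \<open>p'\<close> is the whole domain of its promise.\<close>
  have le': "p' \<preceq> p"
  proof -
    have "Y_set A v g p' p = dom g" for v g by (auto simp: Y_set_def ones')
    moreover have "uncountable (dom g)" if "(v, g) \<in> snd p" for v g
      using p that by (simp add: P_iff promise_def)
    ultimately show ?thesis by (auto simp: P_le_def p'_def restrict_map_dom)
  qed
  obtain q where q: "q \<in> D" "q \<preceq> p'" using D p' by (auto simp: dense_in_def)
  then have "uncountable (Y_set A w f q p')" by (auto simp: P_le_def p'_def)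
  then obtain \<alpha> where \<alpha>: "\<alpha> \<in> Y_set A w f q p'" by fastforce
  then have B: "\<alpha> \<in> B" using Y_set_subset_dom domf by blast
  have "ones q \<xi> - ones p \<xi> \<subseteq> A \<xi> \<alpha> - F \<alpha>" if "\<xi> \<in> w" for \<xi>
  proof -
    have "\<xi> \<in> Field kap" using that w by blast
    moreover have "ones q \<xi> - ones p \<xi> \<subseteq> A \<xi> \<alpha> - (F \<alpha> \<inter> {..<\<alpha>})"
      using \<alpha> that B by (simp add: Y_set_def ones' f_def)
    ultimately show ?thesis using A_below[of \<xi> \<alpha>] by blast
  qed
  moreover have "q \<preceq> p" using P_le_trans q(2) le' by blast
  ultimately have "adds_within p w \<alpha> (F \<alpha>) q" by (simp add: adds_within_def)
  then show False using F(2)[OF B q(1)] by blast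
qed

text \<open>Each of the countably many \<open>w\<close> gets one good ordinal
  \<open>\<alpha> w\<close>. Since \<open>A \<xi> (\<alpha> w)\<close> lies below
  \<open>\<alpha> w\<close>, only the countably many finite
  \<open>F \<subseteq> {..<\<alpha> w}\<close> matter; \<open>\<gamma>\<close> exceeds all
  \<open>\<alpha> w\<close>.\<close>

lemma rich_set:
  assumes p: "p \<in> P" and D: "dense_in P le D"
  shows "\<exists>K \<gamma>. countable K \<and> K \<noteq> {} \<and> K \<subseteq> D \<and>
    (\<forall>\<delta>>\<gamma>. \<forall>w F. finite w \<and> w \<subseteq> supp p \<and> finite F \<longrightarrow> (\<exists>q\<in>K. adds_within p w \<delta> F q))"
proof -
  define W where "W = {w. finite w \<and> w \<subseteq> supp p}"
  have W: "countable W"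
    using countable_Collect_finite_subset[OF supp_countable[OF p]] by (simp add: W_def)
  have WD: "w \<subseteq> Field kap" "finite w" if "w \<in> W" for w
    using that supp_subset_Field[OF p] by (auto simp: W_def)
  have "\<exists>\<alpha>. \<forall>F. finite F \<longrightarrow> (\<exists>q\<in>D. adds_within p w \<alpha> F q)" if "w \<in> W" for w
  proof -
    have "{\<alpha>. \<exists>F. finite F \<and> \<not> (\<exists>q\<in>D. adds_within p w \<alpha> F q)} \<noteq> UNIV"
      using countable_bad[OF p D WD(2,1)[OF that]] uncountable_omega1 by metis
    then show ?thesis by blast
  qed
  then obtain \<alpha> where "\<And>w F. w \<in> W \<Longrightarrow> finite F \<Longrightarrow> \<exists>q\<in>D. adds_within p w (\<alpha> w) F q"
    by metis
  then obtain q where q: "\<And>w F. w \<in> W \<Longrightarrow> finite F \<Longrightarrow>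
      q w F \<in> D \<and> adds_within p w (\<alpha> w) F (q w F)"
    by metis
  define X where "X = (SIGMA w:W. {F. finite F \<and> F \<subseteq> {..<\<alpha> w}})"
  define K where "K = (\<lambda>(w, F). q w F) ` X"
  obtain \<gamma> where \<gamma>: "\<forall>x\<in>\<alpha> ` W. x < \<gamma>"
    using countable_bounded_omega1[OF countable_image[OF W]] by blast
  have "\<exists>r\<in>K. adds_within p w \<delta> F r"
    if "\<gamma> < \<delta>" "w \<in> W" "finite F" for \<delta> w F
  proof -
    note w = WD[OF that(2)]
    have "\<alpha> w < \<gamma>" using \<gamma> that by blast
    then have less: "\<alpha> w < \<delta>" using that(1) by (rule less_trans)
    \<comment> \<open>Avoiding also the finitely many points of
      \<open>A \<xi> (\<alpha> w) - A \<xi> \<delta>\<close> makes an extension chosen for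
      \<open>\<alpha> w\<close> work for \<open>\<delta>\<close>.\<close>
    define F' where "F' = (F \<union> (\<Union>\<xi>\<in>w. A \<xi> (\<alpha> w) - A \<xi> \<delta>)) \<inter> {..<\<alpha> w}"
    have fin: "finite F'" using that(3) w(2) A_almost[OF subsetD[OF w(1)] less] by (simp add: F'_def)
    have "(w, F') \<in> X" using fin that by (auto simp: F'_def X_def)
    then have "q w F' \<in> K" by (force simp: K_def)
    moreover have "A \<xi> (\<alpha> w) - F' \<subseteq> A \<xi> \<delta> - F" if "\<xi> \<in> w" for \<xi>
    proof -
      have "\<xi> \<in> Field kap" using that w(1) by blast
      from A_below[OF this, of "\<alpha> w"] that show ?thesis by (auto simp: F'_def)
    qed
    then have "adds_within p w \<delta> F (q w F')"
      using adds_within_mono[OF conjunct2[OF q[OF that(2) fin]]] by blast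
    ultimately show ?thesis by blast
  qed
  moreover have "countable K" unfolding K_def X_def
    by (intro countable_image countable_SIGMA W)
      (use countable_Collect_finite_subset[OF countable_lessThan_omega1] in simp)
  moreover have "K \<subseteq> D" using q by (auto simp: K_def X_def)
  \<comment> \<open>\<open>K\<close> must be nonempty for \<open>from_nat_into\<close> to enumerate
    it later.\<close>
  moreover have "({}, {}) \<in> X" by (simp add: X_def W_def)
  then have "K \<noteq> {}" by (auto simp: K_def)
  ultimately show ?thesis unfolding W_def by (intro exI[of _ K] exI[of _ \<gamma>]) auto
qed

section \<open>Lower bounds and strongly generic sets\<close>

text \<open>The premises \<open>ones\<close> and \<open>prom\<close> secure what may fail in the
  limit: membership of the unions in the ideals, and uncountability of the part of a promise that
  survives all stages.\<close>

lemma lower_bound: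
  assumes s: "\<And>n. s n \<in> P" "\<And>n. s (Suc n) \<preceq> s n"
    and ones: "\<And>\<xi>. \<xi> \<in> Field kap \<Longrightarrow> (\<Union>n. ones (s n) \<xi>) \<in> I \<xi>"
    and prom: "\<And>n v f. (v, f) \<in> snd (s n) \<Longrightarrow>
      uncountable {\<alpha>\<in>dom f. \<forall>\<xi>\<in>v. (\<Union>m. ones (s m) \<xi>) - ones (s n) \<xi> \<subseteq> A \<xi> \<alpha> - the (f \<alpha>)}"
  shows "\<exists>q\<in>P. \<forall>n. q \<preceq> s n"
proof -
  have mono: "fst (s m) \<subseteq>\<^sub>m fst (s n)" if "m \<le> n" for m n
    using that
  proof (induction n rule: dec_induct)
    case (step n)
    then show ?case using s(2)[of n] map_le_trans unfolding P_le_def by blast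
  qed simp
  \<comment> \<open>The functions cohere, so the stage selected by \<open>SOME\<close> does not
    affect the value.\<close>
  define a where "a x = (if \<exists>n. x \<in> dom (fst (s n)) then fst (s (SOME n. x \<in> dom (fst (s n)))) x
    else None)" for x
  have a: "a x = fst (s n) x" if "x \<in> dom (fst (s n))" for x n
  proof -
    define m where "m = (SOME n. x \<in> dom (fst (s n)))"
    have m: "x \<in> dom (fst (s m))" unfolding m_def using that by (rule someI)
    have "fst (s m) x = fst (s n) x"
    proof (cases "m \<le> n")
      case True
      then show ?thesis using mono m unfolding map_le_def by blast
    next
      case False
      then have "n \<le> m" by simp
      from mono[OF this] that show ?thesis unfolding map_le_def by metis
    qed
    then show ?thesis using that by (auto simp: a_def m_def)
  qed
  have doma: "dom a = (\<Union>n. dom (fst (s n)))"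
  proof (intro subset_antisym subsetI)
    fix x assume "x \<in> dom a"
    then show "x \<in> (\<Union>n. dom (fst (s n)))" by (metis (no_types, lifting) UN_I UNIV_I a_def domIff)
  next
    fix x assume "x \<in> (\<Union>n. dom (fst (s n)))"
    then obtain n where "x \<in> dom (fst (s n))" by blast
    then show "x \<in> dom a" using a[of x n] by (auto simp: dom_def)
  qed
  \<comment> \<open>The bound must contain the restriction of each promise to its own
    \<open>Y_set\<close>. That set depends on the bound only through \<open>a\<close>, so
    \<open>(a, {})\<close> stands in for it without circularity.\<close>
  define \<Psi> where "\<Psi> = (\<Union>n. \<Union>(v, f)\<in>snd (s n). {(v, f), (v, f |` Y_set A v f (a, {}) (s n))})"
  let ?q = "(a, \<Psi>)"
  have ones_a: "ones (a, \<Phi>) \<xi> = (\<Union>n. ones (s n) \<xi>)" for \<xi> \<Phi>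
  proof -
    have "a x = Some True \<longleftrightarrow> (\<exists>n. fst (s n) x = Some True)" for x
    proof
      assume x: "a x = Some True"
      then have "x \<in> (\<Union>n. dom (fst (s n)))" using doma by blast
      then show "\<exists>n. fst (s n) x = Some True" using a x by fastforce
    next
      assume "\<exists>n. fst (s n) x = Some True"
      then obtain n where n: "fst (s n) x = Some True" by blast
      then show "a x = Some True" using a[of x n] by (auto simp: dom_def)
    qed
    then show ?thesis by (auto simp: ones_def)
  qed
  have Y: "uncountable (Y_set A v f (a, \<Phi>) (s n))" if "(v, f) \<in> snd (s n)" for v f n \<Phi>
    using prom[OF that] by (simp add: Y_set_def ones_a)
  have Yindep: "Y_set A v f (a, \<Psi>) r = Y_set A v f (a, {}) r" for v f r
    by (simp add: Y_set_def ones_a)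
  have props: "countable (dom (fst (s n)))" "dom (fst (s n)) \<subseteq> Field kap \<times> UNIV"
    "countable (snd (s n))" "(v, f) \<in> snd (s n) \<Longrightarrow> finite v \<and> v \<subseteq> Field kap \<and> promise f" for n v f
    using s(1)[of n] unfolding P_iff by simp_all
  have "countable \<Psi>" unfolding \<Psi>_def
    by (intro countable_UN) (auto simp: props)
  moreover have "promise (f |` Y_set A v f (a, {}) (s n))" if "(v, f) \<in> snd (s n)" for v f n
    using props(4)[OF that] Y[OF that, of "{}"] Y_set_subset_dom[of A v f "(a, {})" "s n"]
    by (auto simp: promise_def Int_absorb1)
  then have "finite v \<and> v \<subseteq> Field kap \<and> promise f" if "(v, f) \<in> \<Psi>" for v f
    using that props(4) unfolding \<Psi>_def by blast
  moreover have "countable (dom a)" "dom a \<subseteq> Field kap \<times> UNIV"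
    using props(1,2) by (auto simp: doma)
  ultimately have "?q \<in> P" using ones unfolding P_iff by (simp add: ones_a)
  moreover have "?q \<preceq> s n" for n
    using Y Yindep unfolding P_le_def by (auto simp: \<Psi>_def map_le_def a)
  ultimately show ?thesis by blast
qed

text \<open>A triple \<open>(p, w, F)\<close> commits all later extensions of \<open>p\<close> to adding, in the coordinates from
  \<open>w\<close>, only points of \<open>A \<xi> \<delta> - F\<close>.\<close>

definition commit_le :: "omega1 \<Rightarrow> 'k cond \<times> 'k set \<times> omega1 set \<Rightarrow> 'k cond \<times> 'k set \<times> omega1 set \<Rightarrow> bool"
  where "commit_le \<delta> = (\<lambda>(p', w', F') (p, w, F). w \<subseteq> w' \<and> F \<subseteq> F' \<and> adds_within p w \<delta> F p')"

lemma commit_le_refl: "p \<in> P \<Longrightarrow> w \<subseteq> w' \<Longrightarrow> F \<subseteq> F' \<Longrightarrow> commit_le \<delta> (p, w', F') (p, w, F)"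
  by (simp add: commit_le_def adds_within_def P_le_refl)

lemma commit_le_trans:
  assumes "commit_le \<delta> x y" "commit_le \<delta> y z"
  shows "commit_le \<delta> x z"
proof -
  obtain p w F p' w' F' p'' w'' F'' where eq: "x = (p'', w'', F'')" "y = (p', w', F')" "z = (p, w, F)"
    by (cases x, cases y, cases z)
  have "p'' \<preceq> p'" "p' \<preceq> p" using assms unfolding eq commit_le_def adds_within_def by auto
  then have "p'' \<preceq> p" by (rule P_le_trans)
  moreover have "ones p'' \<xi> - ones p \<xi> \<subseteq> A \<xi> \<delta> - F" if "\<xi> \<in> w" for \<xi>
  proof -
    have "ones p'' \<xi> - ones p' \<xi> \<subseteq> A \<xi> \<delta> - F'" "ones p' \<xi> - ones p \<xi> \<subseteq> A \<xi> \<delta> - F" "F \<subseteq> F'"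
      using assms that unfolding eq commit_le_def adds_within_def by auto
    then show ?thesis by blast
  qed
  ultimately show ?thesis using assms unfolding eq commit_le_def adds_within_def by auto
qed

text \<open>For \<open>\<alpha> > \<delta>\<close> the set \<open>g \<alpha>\<close> of points to
  avoid is finite, by \<open>A \<xi> \<delta> \<subseteq>* A \<xi> \<alpha>\<close> and finiteness
  of the value of \<open>f\<close> at \<open>\<alpha>\<close>, and it lies below
  \<open>\<delta>\<close>. As \<open>\<delta>\<close> has only countably many finite subsets, one
  value of \<open>g\<close> occurs uncountably often.\<close>

lemma promise_commitment:
  assumes Y: "uncountable Y" "Y \<subseteq> dom f" and f: "promise f" and v: "finite v" "v \<subseteq> Field kap"
  shows "\<exists>F. finite F \<and> uncountable {\<alpha>\<in>Y. \<forall>\<xi>\<in>v. A \<xi> \<delta> - F \<subseteq> A \<xi> \<alpha> - the (f \<alpha>)}"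
proof -
  define g where "g \<alpha> = (\<Union>\<xi>\<in>v. A \<xi> \<delta> - (A \<xi> \<alpha> - the (f \<alpha>)))" for \<alpha>
  let ?Z = "Y - insert \<delta> {..<\<delta>}"
  have Z: "uncountable ?Z"
    using Y(1) by (intro uncountable_minus_countable) (auto simp: countable_lessThan_omega1)
  have "finite (g \<alpha>)" if "\<alpha> \<in> ?Z" for \<alpha>
  proof -
    have "finite (A \<xi> \<delta> - (A \<xi> \<alpha> - the (f \<alpha>)))" if "\<xi> \<in> v" for \<xi>
    proof (rule finite_subset)
      show "A \<xi> \<delta> - (A \<xi> \<alpha> - the (f \<alpha>)) \<subseteq> (A \<xi> \<delta> - A \<xi> \<alpha>) \<union> the (f \<alpha>)" by blast
      have "\<delta> < \<alpha>" using \<open>\<alpha> \<in> ?Z\<close> by auto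
      then show "finite ((A \<xi> \<delta> - A \<xi> \<alpha>) \<union> the (f \<alpha>))"
        using \<open>\<alpha> \<in> ?Z\<close> Y(2) f v that A_almost[of \<xi>] by (auto simp: promise_def)
    qed
    then show ?thesis using v by (simp add: g_def)
  qed
  moreover have "g \<alpha> \<subseteq> {..<\<delta>}" for \<alpha> using A_below v by (fastforce simp: g_def)
  ultimately have "g ` ?Z \<subseteq> {F. finite F \<and> F \<subseteq> {..<\<delta>}}" by blast
  moreover have "countable {F. finite F \<and> F \<subseteq> {..<\<delta>}}"
    using countable_Collect_finite_subset[OF countable_lessThan_omega1] by simp
  ultimately have "countable (g ` ?Z)" by (rule countable_subset)
  from uncountable_fiber[OF Z this] obtain F where F: "uncountable {x \<in> ?Z. g x = F}" by blast
  have sub: "{x \<in> ?Z. g x = F} \<subseteq> {\<alpha>\<in>Y. \<forall>\<xi>\<in>v. A \<xi> \<delta> - F \<subseteq> A \<xi> \<alpha> - the (f \<alpha>)}"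
    by (auto simp: g_def)
  have "{x \<in> ?Z. g x = F} \<noteq> {}" using F countable_empty by metis
  then obtain x where "x \<in> ?Z" "g x = F" by blast
  then have "finite F" using \<open>\<And>\<alpha>. \<alpha> \<in> ?Z \<Longrightarrow> finite (g \<alpha>)\<close> by blast
  then show ?thesis using F countable_subset[OF sub] by blast
qed

text \<open>A sequence of triples descending in \<open>commit_le \<delta>\<close> is made to meet
  countably many requirements; \<open>lower_bound\<close> then applies to its first
  components.\<close>

lemma strongly_generic_exists:
  assumes M: "countable M" "M \<subseteq> P" and \<D>: "countable \<D>" "\<D> \<noteq> {}" and p0: "p0 \<in> M"
    and \<delta>: "\<And>p D w F. p \<in> M \<Longrightarrow> D \<in> \<D> \<Longrightarrow> finite w \<Longrightarrow> w \<subseteq> supp p \<Longrightarrow> finite F \<Longrightarrow>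
      \<exists>q\<in>M \<inter> D. adds_within p w \<delta> F q"
  shows "\<exists>S. p0 \<in> S \<and> strongly_generic P le M \<D> S"
proof -
  define T where "T = {(p, w, F :: omega1 set). p \<in> M \<and> finite w \<and> w \<subseteq> supp p \<and> finite F}"
  \<comment> \<open>Three kinds of requirement: \<open>ED\<close> enters a dense set;
    \<open>E\<xi>\<close> commits a coordinate of the support, which keeps the union in the ideal;
    \<open>EY\<close> commits \<open>v\<close> with an \<open>F\<close> under which uncountably many
    \<open>\<alpha>\<close> can keep the promise. \<open>EY\<close> is vacuous for conditions not
    below \<open>r\<close>.\<close>
  define ED where "ED D = {(p, w :: 'k set, F :: omega1 set). p \<in> D}" for D :: "'k cond set"
  define E\<xi> where "E\<xi> \<xi> = {(p, w, F :: omega1 set). \<xi> \<in> supp p \<longrightarrow> \<xi> \<in> w}" for \<xi> :: 'k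
  define EY where "EY = (\<lambda>(r, v, f). {(p, w, F). p \<preceq> r \<longrightarrow> v \<subseteq> w \<and>
    uncountable {\<alpha>\<in>Y_set A v f p r. \<forall>\<xi>\<in>v. A \<xi> \<delta> - F \<subseteq> A \<xi> \<alpha> - the (f \<alpha>)}})"
  define \<R> where "\<R> = ED ` \<D> \<union> E\<xi> ` (\<Union>p\<in>M. supp p) \<union> EY ` (SIGMA r:M. snd r)"
  have snd_P: "countable (snd r)" "(v, f) \<in> snd r \<Longrightarrow> finite v \<and> v \<subseteq> Field kap \<and> promise f"
    if "r \<in> M" for r v f
    using subsetD[OF M(2) that] unfolding P_iff by simp_all
  have cR: "countable \<R>" unfolding \<R>_def
    using M \<D>(1) snd_P(1) supp_countable
    by (intro countable_Un countable_image countable_UN countable_SIGMA) (blast | assumption)+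
  have neR: "\<R> \<noteq> {}" using \<D>(2) by (simp add: \<R>_def)
  have dense: "\<exists>y\<in>T. commit_le \<delta> y x \<and> y \<in> E" if "x \<in> T" "E \<in> \<R>" for x E
  proof -
    obtain p w F where x: "x = (p, w, F)" "p \<in> M" "finite w" "w \<subseteq> supp p" "finite F"
      using \<open>x \<in> T\<close> by (auto simp: T_def)
    have pP: "p \<in> P" using x(2) M(2) by blast
    consider (D) D where "D \<in> \<D>" "E = ED D" | (\<xi>) \<xi> where "E = E\<xi> \<xi>"
      | (Y) r v f where "r \<in> M" "(v, f) \<in> snd r" "E = EY (r, v, f)"
      using \<open>E \<in> \<R>\<close> unfolding \<R>_def by (elim UnE imageE UN_E SigmaE) (auto split: prod.splits)
    then show ?thesis
    proof cases
      case D
      obtain q where q: "q \<in> M" "q \<in> D" "adds_within p w \<delta> F q" using \<delta>[OF x(2) D(1) x(3-5)] by blast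
      then have "w \<subseteq> supp q" using supp_mono x(4) unfolding adds_within_def by blast
      with q x D(2) show ?thesis
        by (intro bexI[of _ "(q, w, F)"]) (auto simp: T_def ED_def commit_le_def)
    next
      case \<xi>
      show ?thesis
      proof (cases "\<xi> \<in> supp p")
        case True
        then have "(p, insert \<xi> w, F) \<in> T" using x by (simp add: T_def)
        moreover have "(p, insert \<xi> w, F) \<in> E" by (simp add: \<xi> E\<xi>_def)
        ultimately show ?thesis using commit_le_refl[OF pP, of w "insert \<xi> w" F F] x(1) by blast
      next
        case False
        then have "x \<in> E" by (simp add: \<xi> E\<xi>_def x)
        then show ?thesis using commit_le_refl[OF pP, of w w F F] x(1) \<open>x \<in> T\<close> by blast
      qed
    next
      case Y
      note v = snd_P(2)[OF Y(1,2)]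
      show ?thesis
      proof (cases "p \<preceq> r")
        case True
        then have "uncountable (Y_set A v f p r)" using Y(2) by (auto simp: P_le_def)
        then have "\<exists>G. finite G \<and>
            uncountable {\<alpha>\<in>Y_set A v f p r. \<forall>\<xi>\<in>v. A \<xi> \<delta> - G \<subseteq> A \<xi> \<alpha> - the (f \<alpha>)}"
          by (rule promise_commitment[OF _ Y_set_subset_dom]) (use v in simp_all)
        then obtain G where G: "finite G"
          "uncountable {\<alpha>\<in>Y_set A v f p r. \<forall>\<xi>\<in>v. A \<xi> \<delta> - G \<subseteq> A \<xi> \<alpha> - the (f \<alpha>)}" by blast
        have sub: "{\<alpha>\<in>Y_set A v f p r. \<forall>\<xi>\<in>v. A \<xi> \<delta> - G \<subseteq> A \<xi> \<alpha> - the (f \<alpha>)} \<subseteq>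
            {\<alpha>\<in>Y_set A v f p r. \<forall>\<xi>\<in>v. A \<xi> \<delta> - (F \<union> G) \<subseteq> A \<xi> \<alpha> - the (f \<alpha>)}" by blast
        have "uncountable {\<alpha>\<in>Y_set A v f p r. \<forall>\<xi>\<in>v. A \<xi> \<delta> - (F \<union> G) \<subseteq> A \<xi> \<alpha> - the (f \<alpha>)}"
          using G(2) countable_subset[OF sub] by blast
        then have "(p, w \<union> v, F \<union> G) \<in> E" by (simp add: Y(3) EY_def)
        moreover have "v \<subseteq> supp r" using Y(2) by (force simp: supp_def)
        then have "v \<subseteq> supp p" using supp_mono[OF True] by blast
        then have "(p, w \<union> v, F \<union> G) \<in> T" using x v G(1) by (simp add: T_def)
        ultimately show ?thesis
          using commit_le_refl[OF pP, of w "w \<union> v" F "F \<union> G"] x(1) by blast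
      next
        case False
        then have "x \<in> E" by (simp add: Y(3) EY_def x)
        then show ?thesis using commit_le_refl[OF pP, of w w F F] x(1) \<open>x \<in> T\<close> by blast
      qed
    qed
  qed
  have t0: "(p0, {}, {}) \<in> T" using p0 by (simp add: T_def)
  obtain t where t: "t 0 = (p0, {}, {})" "\<And>n. t n \<in> T" "\<And>n. commit_le \<delta> (t (Suc n)) (t n)"
      "\<And>i m. \<exists>n\<ge>m. t n \<in> from_nat_into \<R> i"
    using generic_sequence[OF t0, of "commit_le \<delta>" "from_nat_into \<R>"]
      dense from_nat_into[OF neR] by blast
  have t_meets: "\<exists>n\<ge>m. t n \<in> E" if "E \<in> \<R>" for E m
    using t(4)[of m "to_nat_on \<R> E"] from_nat_into_to_nat_on[OF cR that] by simp
  define s where "s n = fst (t n)" for n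
  define w where "w n = fst (snd (t n))" for n
  define F where "F n = snd (snd (t n))" for n
  have t_eq: "t n = (s n, w n, F n)" for n by (simp add: s_def w_def F_def)
  have sM: "s n \<in> M" for n using t(2)[of n] by (auto simp: t_eq T_def)
  have sP: "s n \<in> P" for n using sM M(2) by blast
  have t_le: "commit_le \<delta> (t n) (t m)" if "m \<le> n" for m n
    using that
  proof (induction n rule: dec_induct)
    case base
    then show ?case using commit_le_refl[OF sP] by (simp add: t_eq)
  next
    case (step n)
    then show ?case using commit_le_trans t(3) by blast
  qed
  have s_le: "s n \<preceq> s m"
    and adds: "\<xi> \<in> w m \<Longrightarrow> ones (s n) \<xi> - ones (s m) \<xi> \<subseteq> A \<xi> \<delta> - F m" if "m \<le> n" for m n \<xi>
    using t_le[OF that] by (auto simp: t_eq commit_le_def adds_within_def)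
  have ones_s: "ones (s m) \<xi> \<subseteq> ones (s n) \<xi>" if "m \<le> n" for m n \<xi>
    using s_le[OF that] by (intro ones_mono) (simp add: P_le_def)
  \<comment> \<open>Stages before \<open>m\<close> contribute nothing, since
    \<open>ones (s n) \<xi>\<close> increases with \<open>n\<close>.\<close>
  have adds_UN: "(\<Union>n. ones (s n) \<xi>) - ones (s m) \<xi> \<subseteq> A \<xi> \<delta> - F m" if "\<xi> \<in> w m" for m \<xi>
  proof -
    have "ones (s n) \<xi> - ones (s m) \<xi> \<subseteq> A \<xi> \<delta> - F m" for n
      using adds[OF _ that, of n] ones_s[of n m \<xi>] nat_le_linear[of m n] by blast
    then show ?thesis by blast
  qed
  have in_I: "(\<Union>n. ones (s n) \<xi>) \<in> I \<xi>" if \<xi>: "\<xi> \<in> Field kap" for \<xi>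
  proof (cases "\<exists>m. \<xi> \<in> supp (s m)")
    case True
    then obtain m where m: "\<xi> \<in> supp (s m)" by blast
    then have "E\<xi> \<xi> \<in> \<R>" using sM unfolding \<R>_def by blast
    then obtain n where n: "n \<ge> m" "t n \<in> E\<xi> \<xi>" using t_meets by blast
    \<comment> \<open>Supports grow, so \<open>E\<xi> \<xi>\<close> is not met vacuously at stage
      \<open>n\<close>; from then on only points of \<open>A \<xi> \<delta>\<close> are
      added.\<close>
    have "\<xi> \<in> supp (s n)" using supp_mono[OF s_le[OF n(1)]] m by blast
    then have "\<xi> \<in> w n" using n(2) by (simp add: E\<xi>_def t_eq)
    from adds_UN[OF this] have "(\<Union>n. ones (s n) \<xi>) \<subseteq> ones (s n) \<xi> \<union> A \<xi> \<delta>" by blast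
    then show ?thesis using ideal_subset[OF \<xi> ideal_Un[OF \<xi> ones_in[OF sP \<xi>] A_in[OF \<xi>]]] by blast
  next
    case False
    then have "ones (s n) \<xi> = {}" for n using ones_subset_supp[of _ "s n" \<xi>] by blast
    then have "(\<Union>n. ones (s n) \<xi>) = {}" by simp
    then show ?thesis using ideal_subset[OF \<xi> A_in[OF \<xi>] empty_subsetI] by simp
  qed
  have unc: "uncountable
      {\<alpha>\<in>dom f. \<forall>\<xi>\<in>v. (\<Union>m. ones (s m) \<xi>) - ones (s n) \<xi> \<subseteq> A \<xi> \<alpha> - the (f \<alpha>)}"
    if vf: "(v, f) \<in> snd (s n)" for n v f
  proof -
    have "EY (s n, v, f) \<in> \<R>" using sM vf unfolding \<R>_def by blast
    then obtain m where m: "m \<ge> n" "t m \<in> EY (s n, v, f)" using t_meets by blast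
    then have vw: "v \<subseteq> w m" and unc: "uncountable
        {\<alpha>\<in>Y_set A v f (s m) (s n). \<forall>\<xi>\<in>v. A \<xi> \<delta> - F m \<subseteq> A \<xi> \<alpha> - the (f \<alpha>)}" (is "uncountable ?Z")
      using s_le[OF m(1)] by (simp_all add: EY_def t_eq)
    \<comment> \<open>Points added between stages \<open>n\<close> and \<open>m\<close> are
      controlled by \<open>Y_set A v f (s m) (s n)\<close>, those added after \<open>m\<close> by
      the commitment avoiding \<open>F m\<close>.\<close>
    have "(\<Union>m. ones (s m) \<xi>) - ones (s n) \<xi> \<subseteq> A \<xi> \<alpha> - the (f \<alpha>)" if "\<alpha> \<in> ?Z" "\<xi> \<in> v" for \<alpha> \<xi>
    proof -
      have "\<xi> \<in> w m" using vw that by blast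
      from adds_UN[OF this] have "(\<Union>m. ones (s m) \<xi>) - ones (s m) \<xi> \<subseteq> A \<xi> \<alpha> - the (f \<alpha>)"
        using that by blast
      moreover have "ones (s m) \<xi> - ones (s n) \<xi> \<subseteq> A \<xi> \<alpha> - the (f \<alpha>)"
        using that by (auto simp: Y_set_def)
      ultimately show ?thesis by blast
    qed
    moreover have "?Z \<subseteq> dom f" using Y_set_subset_dom by blast
    ultimately have sub: "?Z \<subseteq>
      {\<alpha>\<in>dom f. \<forall>\<xi>\<in>v. (\<Union>m. ones (s m) \<xi>) - ones (s n) \<xi> \<subseteq> A \<xi> \<alpha> - the (f \<alpha>)}" by blast
    show ?thesis using unc countable_subset[OF sub] by (rule contrapos_nn)
  qed
  have bound: "\<exists>q\<in>P. \<forall>n. q \<preceq> s n"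
    by (rule lower_bound[OF sP s_le in_I unc]) simp_all
  have "strongly_generic P le M \<D> (range s)" unfolding strongly_generic_def
  proof (intro conjI ballI)
    show "range s \<subseteq> M" using sM by blast
    show "\<exists>z\<in>range s. z \<preceq> x \<and> z \<preceq> y" if "x \<in> range s" "y \<in> range s" for x y
    proof -
      obtain m n where "x = s m" "y = s n" using \<open>x \<in> range s\<close> \<open>y \<in> range s\<close> by blast
      then show ?thesis using s_le[of m "max m n"] s_le[of n "max m n"] by auto
    qed
    show "range s \<inter> D \<noteq> {}" if "D \<in> \<D>" for D
    proof -
      have "ED D \<in> \<R>" using that by (simp add: \<R>_def)
      then obtain n where "t n \<in> ED D" using t_meets by blast
      then show ?thesis by (auto simp: ED_def t_eq)
    qed
    show "\<exists>q\<in>P. \<forall>x\<in>range s. q \<preceq> x" using bound by blast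
  qed
  moreover have "p0 \<in> range s" using t(1) by (auto simp: s_def intro!: image_eqI[of _ _ 0])
  ultimately show ?thesis by blast
qed

text \<open>\<open>G p D\<close> enumerates the countable set \<open>K p D\<close> supplied by
  \<open>rich_set\<close>, so a set closed under \<open>G\<close> contains all of
  \<open>K p D\<close>.\<close>

lemma generically_closing_exists: "\<exists>G. generically_closing P le G"
proof -
  have "\<exists>K \<gamma>. p \<in> P \<and> dense_in P le D \<longrightarrow> countable K \<and> K \<noteq> {} \<and> K \<subseteq> D \<and>
    (\<forall>\<delta>>\<gamma>. \<forall>w F. finite w \<and> w \<subseteq> supp p \<and> finite F \<longrightarrow> (\<exists>q\<in>K. adds_within p w \<delta> F q))" for p D
  proof (cases "p \<in> P \<and> dense_in P le D")
    case True
    then show ?thesis using rich_set[of p D] by simp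
  qed blast
  then obtain K \<gamma> where K\<gamma>: "\<And>p D. p \<in> P \<and> dense_in P le D \<longrightarrow> countable (K p D) \<and> K p D \<noteq> {} \<and>
    K p D \<subseteq> D \<and> (\<forall>\<delta>>\<gamma> p D. \<forall>w F. finite w \<and> w \<subseteq> supp p \<and> finite F \<longrightarrow>
      (\<exists>q\<in>K p D. adds_within p w \<delta> F q))" by metis
  have K: "countable (K p D)" "K p D \<noteq> {}" "K p D \<subseteq> D"
    and \<gamma>: "\<And>\<delta> w F. \<gamma> p D < \<delta> \<Longrightarrow> finite w \<Longrightarrow> w \<subseteq> supp p \<Longrightarrow> finite F \<Longrightarrow>
      \<exists>q\<in>K p D. adds_within p w \<delta> F q"
    if "p \<in> P" "dense_in P le D" for p D
    using K\<gamma>[of p D] that by simp_all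
  let ?G = "\<lambda>p D. from_nat_into (K p D)"
  have G_in: "?G p D k \<in> P" if "p \<in> P" "dense_in P le D" for p D k
    using from_nat_into[OF K(2)[OF that], of k] K(3)[OF that] that(2) by (auto simp: dense_in_def)
  have generic: "\<exists>S. p \<in> S \<and> strongly_generic P le M \<D> S"
    if M: "countable M" "M \<subseteq> P" and \<D>: "countable \<D>" "\<And>D. D \<in> \<D> \<Longrightarrow> dense_in P le D"
      and closed: "\<And>p D k. p \<in> M \<Longrightarrow> D \<in> \<D> \<Longrightarrow> ?G p D k \<in> M" and p: "p \<in> M" for M \<D> p
  proof (cases "\<D> = {}")
    case True
    have "p \<preceq> p" "p \<in> P" using P_le_refl M(2) p by blast+
    then have "strongly_generic P le M \<D> {p}" using p by (auto simp: strongly_generic_def True)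
    then show ?thesis by blast
  next
    case False
    \<comment> \<open>Countably many pairs \<open>(p, D)\<close> occur, so a single
      \<open>\<delta>\<close> lies above all their bounds.\<close>
    obtain \<delta> where \<delta>: "\<forall>x\<in>(\<lambda>(p, D). \<gamma> p D) ` (M \<times> \<D>). x < \<delta>"
      using countable_bounded_omega1[OF countable_image[OF countable_SIGMA[OF M(1) \<D>(1)]]] by blast
    show ?thesis
    proof (rule strongly_generic_exists[OF M \<D>(1) False p])
      fix q D w F assume *: "q \<in> M" "D \<in> \<D>" "finite w" "w \<subseteq> supp q" "finite (F :: omega1 set)"
      then have q: "q \<in> P" and D: "dense_in P le D" using M(2) \<D>(2) by blast+
      have "\<gamma> q D < \<delta>" using \<delta> *(1,2) by blast
      then obtain r where r: "r \<in> K q D" "adds_within q w \<delta> F r" using \<gamma>[OF q D _ *(3-5)] by blast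
      then have "r = ?G q D (to_nat_on (K q D) r)"
        using from_nat_into_to_nat_on[OF K(1)[OF q D]] by simp
      then have "r \<in> M" using closed[OF *(1,2)] by metis
      then show "\<exists>q'\<in>M \<inter> D. adds_within q w \<delta> F q'" using r K(3)[OF q D] by blast
    qed
  qed
  have "generically_closing P le ?G" unfolding generically_closing_def
  proof (intro conjI ballI allI impI)
    show "?G p D k \<in> P" if "p \<in> P" "dense_in P le D" for p D k using G_in that .
    fix M \<D> p
    assume *: "countable M \<and> M \<subseteq> P \<and> countable \<D> \<and>
        (\<forall>D\<in>\<D>. dense_in P le D \<and> (\<forall>p\<in>M. \<forall>k. ?G p D k \<in> M))" and "p \<in> M"
    show "\<exists>S. p \<in> S \<and> strongly_generic P le M \<D> S"
      by (rule generic[OF _ _ _ _ _ \<open>p \<in> M\<close>]) (use * in simp_all)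
  qed
  then show ?thesis by (rule exI[of _ ?G])
qed

end

section \<open>Definability and elementary submodels\<close>

primrec fm_bound :: "fm \<Rightarrow> nat" where
  "fm_bound (Mem i j) = Suc (max i j)"
| "fm_bound (Eq i j) = Suc (max i j)"
| "fm_bound (Neg \<phi>) = fm_bound \<phi>"
| "fm_bound (Conj \<phi> \<psi>) = max (fm_bound \<phi>) (fm_bound \<psi>)"
| "fm_bound (Ex i \<phi>) = max (Suc i) (fm_bound \<phi>)"

lemma sat_cong: "(\<And>k. k < fm_bound \<phi> \<Longrightarrow> e k = e' k) \<Longrightarrow> sat M \<phi> e \<longleftrightarrow> sat M \<phi> e'"
proof (induction \<phi> arbitrary: e e')
  case (Ex i \<phi>)
  have "sat M \<phi> (e(i := x)) \<longleftrightarrow> sat M \<phi> (e'(i := x))" for x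
    by (rule Ex.IH) (simp add: Ex.prems)
  then show ?case by simp
next
  case (Conj \<phi> \<psi>)
  have "sat M \<phi> e \<longleftrightarrow> sat M \<phi> e'" "sat M \<psi> e \<longleftrightarrow> sat M \<psi> e'"
    by (rule Conj.IH; simp add: Conj.prems)+
  then show ?case by simp
next
  case (Neg \<phi>)
  have "sat M \<phi> e \<longleftrightarrow> sat M \<phi> e'" by (rule Neg.IH) (simp add: Neg.prems)
  then show ?case by simp
qed simp_all

primrec rename_fm :: "(nat \<Rightarrow> nat) \<Rightarrow> fm \<Rightarrow> fm" where
  "rename_fm \<sigma> (Mem i j) = Mem (\<sigma> i) (\<sigma> j)"
| "rename_fm \<sigma> (Eq i j) = Eq (\<sigma> i) (\<sigma> j)"
| "rename_fm \<sigma> (Neg \<phi>) = Neg (rename_fm \<sigma> \<phi>)"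
| "rename_fm \<sigma> (Conj \<phi> \<psi>) = Conj (rename_fm \<sigma> \<phi>) (rename_fm \<sigma> \<psi>)"
| "rename_fm \<sigma> (Ex i \<phi>) = Ex (\<sigma> i) (rename_fm \<sigma> \<phi>)"

text \<open>Injectivity prevents capture: updating the renamed variable changes no other
  one.\<close>

lemma sat_rename_fm:
  assumes "inj \<sigma>"
  shows "sat M (rename_fm \<sigma> \<phi>) e \<longleftrightarrow> sat M \<phi> (e \<circ> \<sigma>)"
proof (induction \<phi> arbitrary: e)
  case (Ex i \<phi>)
  have "e(\<sigma> i := x) \<circ> \<sigma> = (e \<circ> \<sigma>)(i := x)" for x
    using assms by (auto simp: fun_eq_iff inj_eq)
  then show ?case by (simp add: Ex.IH del: fun_upd_apply o_apply)
qed simp_all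

text \<open>Predicates on assignments stand in for formulas, so that definability can be derived by
  introduction rules along the syntax of a HOL expression.\<close>

definition definable :: "'l hset set \<Rightarrow> ((nat \<Rightarrow> 'l hset) \<Rightarrow> bool) \<Rightarrow> bool" where
  "definable M R \<longleftrightarrow> (\<exists>\<phi>. \<forall>e. range e \<subseteq> M \<longrightarrow> (sat M \<phi> e \<longleftrightarrow> R e))"

lemma definableI: "(\<And>e. range e \<subseteq> M \<Longrightarrow> sat M \<phi> e \<longleftrightarrow> R e) \<Longrightarrow> definable M R"
  unfolding definable_def by (intro exI[of _ \<phi>] allI impI)

lemma definableE:
  assumes "definable M R"
  obtains \<phi> where "\<forall>e. range e \<subseteq> M \<longrightarrow> (sat M \<phi> e \<longleftrightarrow> R e)"
  using assms unfolding definable_def ..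

lemma definable_mem: "definable M (\<lambda>e. e i \<in> elts (e j))"
  by (rule definableI[of M "Mem i j"]) (simp add: elts_def)

lemma definable_eq: "definable M (\<lambda>e. e i = e j)"
  by (rule definableI[of M "Eq i j"]) simp

lemma definable_not:
  assumes "definable M R"
  shows "definable M (\<lambda>e. \<not> R e)"
proof -
  obtain \<phi> where "\<forall>e. range e \<subseteq> M \<longrightarrow> (sat M \<phi> e \<longleftrightarrow> R e)" by (rule definableE[OF assms])
  then show ?thesis by (intro definableI[of M "Neg \<phi>"]) simp
qed

lemma definable_conj:
  assumes "definable M R" "definable M R'"
  shows "definable M (\<lambda>e. R e \<and> R' e)"
proof -
  obtain \<phi> where "\<forall>e. range e \<subseteq> M \<longrightarrow> (sat M \<phi> e \<longleftrightarrow> R e)" by (rule definableE[OF assms(1)])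
  moreover obtain \<psi> where "\<forall>e. range e \<subseteq> M \<longrightarrow> (sat M \<psi> e \<longleftrightarrow> R' e)" by (rule definableE[OF assms(2)])
  ultimately show ?thesis by (intro definableI[of M "Conj \<phi> \<psi>"]) simp
qed

lemma definable_disj:
  assumes "definable M R" "definable M R'"
  shows "definable M (\<lambda>e. R e \<or> R' e)"
  using definable_not[OF definable_conj[OF definable_not[OF assms(1)] definable_not[OF assms(2)]]]
  by (simp only: de_Morgan_conj not_not)

lemma definable_imp:
  assumes "definable M R" "definable M R'"
  shows "definable M (\<lambda>e. R e \<longrightarrow> R' e)"
  unfolding imp_conv_disj by (rule definable_disj[OF definable_not[OF assms(1)] assms(2)])

text \<open>In the premise the quantified variable is named by \<open>0\<close> and the others are shifted, so that no
  freshness conditions arise.\<close>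

lemma definable_bex:
  assumes "definable M (\<lambda>e. Q (\<lambda>n. e (Suc n)) (e 0))"
  shows "definable M (\<lambda>e. \<exists>x\<in>M. Q e x)"
proof -
  obtain \<phi> where \<phi>: "\<forall>e. range e \<subseteq> M \<longrightarrow> (sat M \<phi> e \<longleftrightarrow> Q (\<lambda>n. e (Suc n)) (e 0))"
    by (rule definableE[OF assms])
  define n where "n = fm_bound \<phi>"
  \<comment> \<open>\<open>n\<close> exceeds every variable of \<open>\<phi>\<close>, bound ones
    included. The map \<open>\<sigma>\<close> is a cycle on the numbers up to \<open>n\<close>: it
    sends \<open>0\<close> to \<open>n\<close> and undoes the shift of the others.\<close>
  define \<sigma> where "\<sigma> k = (if k = 0 then n else if k \<le> n then k - 1 else k)" for k
  have "inj \<sigma>" by (rule injI) (auto simp: \<sigma>_def split: if_splits)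
  have "sat M (Ex n (rename_fm \<sigma> \<phi>)) e \<longleftrightarrow> (\<exists>x\<in>M. Q e x)" if e: "range e \<subseteq> M" for e
  proof -
    have "sat M (rename_fm \<sigma> \<phi>) (e(n := x)) \<longleftrightarrow> Q e x" if "x \<in> M" for x
    proof -
      have "sat M (rename_fm \<sigma> \<phi>) (e(n := x)) \<longleftrightarrow> sat M \<phi> (e(n := x) \<circ> \<sigma>)"
        by (rule sat_rename_fm[OF \<open>inj \<sigma>\<close>])
      also have "\<dots> \<longleftrightarrow> sat M \<phi> (case_nat x e)"
        by (rule sat_cong) (auto simp: \<sigma>_def n_def split: nat.splits)
      also have "\<dots> \<longleftrightarrow> Q e x"
      proof -
        have "range (case_nat x e) \<subseteq> M" using e that by (auto simp: image_subset_iff split: nat.splits)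
        with \<phi> show ?thesis by simp
      qed
      finally show ?thesis .
    qed
    then show ?thesis by simp
  qed
  then show ?thesis by (rule definableI)
qed

lemma definable_ball:
  assumes "definable M (\<lambda>e. Q (\<lambda>n. e (Suc n)) (e 0))"
  shows "definable M (\<lambda>e. \<forall>x\<in>M. Q e x)"
  using definable_not[OF definable_bex[of M "\<lambda>e x. \<not> Q e x", OF definable_not[OF assms]]] by simp

text \<open>Elementarity is applied twice: to the existential formula, and to its matrix at the
  witness found in \<open>N\<close>. Surplus parameter places can be filled with any members of
  \<open>N\<close>.\<close>

lemma elementary_reflects:
  assumes N: "N \<prec> M" and R: "definable M (\<lambda>e. R (e 0) (e 1) (e 2) (e 3))"
    and abc: "a \<in> N" "b \<in> N" "c \<in> N" and ex: "\<exists>x\<in>M. R x a b c"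
  shows "\<exists>x\<in>N. R x a b c"
proof -
  obtain \<phi> where \<phi>: "\<forall>e. range e \<subseteq> M \<longrightarrow> (sat M \<phi> e \<longleftrightarrow> R (e 0) (e 1) (e 2) (e 3))"
    by (rule definableE[OF R])
  have NM: "N \<subseteq> M" and elem: "\<And>\<phi> e. range e \<subseteq> N \<Longrightarrow> sat N \<phi> e \<longleftrightarrow> sat M \<phi> e"
    using N by (auto simp: elementary_def)
  define e where "e n = (if n = 1 then a else if n = 2 then b else c)" for n :: nat
  have e: "range (e(0 := x)) \<subseteq> insert x N" "range e \<subseteq> N" for x using abc by (auto simp: e_def)
  have sat: "sat M \<phi> (e(0 := x)) \<longleftrightarrow> R x a b c" if "x \<in> M" for x
  proof -
    have "range (e(0 := x)) \<subseteq> M" using e(1)[of x] NM that by (meson insert_subset order_trans)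
    with \<phi> show ?thesis by (simp add: e_def)
  qed
  have "sat M (Ex 0 \<phi>) e" using ex sat by auto
  then have "sat N (Ex 0 \<phi>) e" using elem[OF e(2)] by blast
  then obtain x where x: "x \<in> N" "sat N \<phi> (e(0 := x))" by auto
  have "sat M \<phi> (e(0 := x))" using x elem[of "e(0 := x)"] e(1)[of x] by (simp add: insert_absorb)
  then show ?thesis using sat x(1) NM by blast
qed

section \<open>Small sets, pairs and bounded quantifiers in H(lambda)\<close>

locale hereditary_universe =
  fixes lam :: "'l rel"
  assumes lam: "uncountable_regular lam"
begin

abbreviation H :: "'l hset set" where "H \<equiv> H_of lam"

lemma lam_props: "Card_order lam" "natLeq <o lam" "\<not> finite (Field lam)" "lam \<le>o |UNIV :: 'l set|"
proof -
  show card: "Card_order lam" and unc: "natLeq <o lam"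
    using lam by (auto simp: uncountable_regular_def)
  show "\<not> finite (Field lam)"
    using unc card
    by (meson infinite_iff_natLeq_ordLeq card_of_Field_ordIso ordIso_symmetric
        ordLeq_ordIso_trans ordLess_imp_ordLeq)
  show "lam \<le>o |UNIV :: 'l set|"
    using card_of_Field_ordIso[OF card] card_of_mono1[OF subset_UNIV, of "Field lam"]
      ordIso_ordLeq_trans ordIso_symmetric by blast
qed

lemma countable_small: "countable A \<Longrightarrow> |A| <o lam"
  using lam_props(2) countable_iff_natLeq ordLeq_ordLess_trans by blast

lemma small_image: "|A| <o lam \<Longrightarrow> |f ` A| <o lam"
  using card_of_image ordLeq_ordLess_trans by blast

lemma small_Times: "|A| <o lam \<Longrightarrow> |B| <o lam \<Longrightarrow> |A \<times> B| <o lam"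
proof -
  assume A: "|A| <o lam" and B: "|B| <o lam"
  have "stable lam"
    using regularCard_stable[OF lam_props(1,3)] lam by (simp add: uncountable_regular_def)
  then have "|\<Union>a\<in>A. Pair a ` B| <o lam"
    by (rule stable_UNION[OF _ A small_image[OF B]])
  moreover have "(\<Union>a\<in>A. Pair a ` B) = A \<times> B" by auto
  ultimately show "|A \<times> B| <o lam" by simp
qed

lemma small_UNIV: "|A| <o lam \<Longrightarrow> |A| \<le>o |UNIV :: 'l set|"
  using lam_props(4) ordLess_imp_ordLeq ordLeq_transitive by blast

lemma elts_HSet_small: "|A| <o lam \<Longrightarrow> elts (HSet A) = A" for A :: "'l hset set"
  by (rule elts_HSet[OF small_UNIV])

lemma HSet_in_H: "|A| <o lam \<Longrightarrow> A \<subseteq> H \<Longrightarrow> HSet A \<in> H"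
  using H_closed[OF lam, of A] elts_HSet_small hset_ext by metis

lemma HSet_elts: "HSet (elts x) = x" for x :: "'l hset"
  by (rule hset_ext, rule elts_HSet[OF card_of_elts])

lemma elts_finite_HSet [simp]: "finite A \<Longrightarrow> elts (HSet A) = A" for A :: "'l hset set"
  by (simp add: elts_HSet_small countable_small countable_finite)

lemma H_trans: "x \<in> H \<Longrightarrow> y \<in> elts x \<Longrightarrow> y \<in> H"
  by (rule elts_in_H)

text \<open>The right-hand side uses only quantifiers over elements, so the definability rules apply
  to it as it stands.\<close>

lemma hpair_iff: "z = hpair x y \<longleftrightarrow> (\<exists>a\<in>elts z. \<exists>b\<in>elts z. (x \<in> elts a \<and> (\<forall>t\<in>elts a. t = x)) \<and>
    (x \<in> elts b \<and> y \<in> elts b \<and> (\<forall>t\<in>elts b. t = x \<or> t = y)) \<and> (\<forall>t\<in>elts z. t = a \<or> t = b))"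
  for x y z :: "'l hset"
proof -
  have sing: "x \<in> elts a \<and> (\<forall>t\<in>elts a. t = x) \<longleftrightarrow> a = HSet {x}" for a
  proof
    assume "x \<in> elts a \<and> (\<forall>t\<in>elts a. t = x)"
    then have "elts a = {x}" by blast
    then show "a = HSet {x}" using HSet_elts[of a] by simp
  qed simp
  have dbl: "x \<in> elts b \<and> y \<in> elts b \<and> (\<forall>t\<in>elts b. t = x \<or> t = y) \<longleftrightarrow> b = HSet {x, y}" for b
  proof
    assume "x \<in> elts b \<and> y \<in> elts b \<and> (\<forall>t\<in>elts b. t = x \<or> t = y)"
    then have "elts b = {x, y}" by blast
    then show "b = HSet {x, y}" using HSet_elts[of b] by simp
  qed simp
  have "z = hpair x y \<longleftrightarrow> elts z = {HSet {x}, HSet {x, y}}"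
    unfolding hpair_def by (metis HSet_elts elts_finite_HSet finite.emptyI finite.insertI)
  then show ?thesis unfolding sing dbl by blast
qed

lemma hpair_inject: "hpair x y = hpair x' y' \<longleftrightarrow> x = x' \<and> y = y'" for x y x' y' :: "'l hset"
proof
  have elts_hpair: "elts ` elts (hpair x y) = {{x}, {x, y}}" for x y :: "'l hset"
    by (simp add: hpair_def)
  assume "hpair x y = hpair x' y'"
  then have "{{x}, {x, y}} = {{x'}, {x', y'}}" by (metis elts_hpair)
  then show "x = x' \<and> y = y'" by (auto simp: doubleton_eq_iff)
qed simp

lemma hpair_in_H: "x \<in> H \<Longrightarrow> y \<in> H \<Longrightarrow> hpair x y \<in> H"
  unfolding hpair_def by (intro HSet_in_H countable_small) (auto intro!: HSet_in_H countable_small)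

lemma hpair_components_in_H:
  assumes "hpair x y \<in> H"
  shows "x \<in> H" "y \<in> H"
proof -
  have "HSet {x, y} \<in> elts (hpair x y)" by (simp add: hpair_def)
  then have "HSet {x, y} \<in> H" by (rule H_trans[OF assms])
  then show "x \<in> H" "y \<in> H" by (rule H_trans; simp)+
qed

text \<open>\<open>H\<close> is transitive, so every witness in \<open>elts (e j)\<close> is already
  in \<open>H\<close>.\<close>

lemma definable_bex_elts:
  assumes "definable H (\<lambda>e. Q (\<lambda>n. e (Suc n)) (e 0))"
  shows "definable H (\<lambda>e. \<exists>x\<in>elts (e j). Q e x)"
proof -
  have "definable H (\<lambda>e. \<exists>x\<in>H. x \<in> elts (e j) \<and> Q e x)"
    by (intro definable_bex definable_conj definable_mem assms)
  then obtain \<phi> where \<phi>: "\<forall>e. range e \<subseteq> H \<longrightarrow> (sat H \<phi> e \<longleftrightarrow> (\<exists>x\<in>H. x \<in> elts (e j) \<and> Q e x))"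
    by (rule definableE)
  have "(\<exists>x\<in>H. x \<in> elts (e j) \<and> Q e x) \<longleftrightarrow> (\<exists>x\<in>elts (e j). Q e x)" if "range e \<subseteq> H" for e
    using that H_trans by blast
  with \<phi> show ?thesis by (intro definableI[of H \<phi>]) simp
qed

lemma definable_ball_elts:
  assumes "definable H (\<lambda>e. Q (\<lambda>n. e (Suc n)) (e 0))"
  shows "definable H (\<lambda>e. \<forall>x\<in>elts (e j). Q e x)"
  using definable_not[OF definable_bex_elts[of "\<lambda>e x. \<not> Q e x", OF definable_not[OF assms]]] by simp

lemmas definable_basic = definable_mem definable_eq definable_not definable_conj definable_disj
  definable_imp definable_bex definable_ball definable_bex_elts definable_ball_elts

lemma definable_hpair: "definable H (\<lambda>e. e i = hpair (e j) (e k))"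
  unfolding hpair_iff by (intro definable_basic)

lemma definable_hpair_mem: "definable H (\<lambda>e. hpair (e i) (e j) \<in> elts (e k))"
proof -
  have "definable H (\<lambda>e. \<exists>z\<in>elts (e k). z = hpair (e i) (e j))"
    by (intro definable_basic definable_hpair)
  then show ?thesis by (simp add: Bex_def)
qed

lemmas definable_intros = definable_basic definable_hpair definable_hpair_mem

end

section \<open>Transfer to elementary submodels\<close>

context hereditary_universe
begin

section \<open>Numerals and the first-order closure property\<close>

definition singleton_of :: "'l hset \<Rightarrow> 'l hset \<Rightarrow> bool" where
  "singleton_of y x \<longleftrightarrow> x \<in> elts y \<and> (\<forall>t\<in>elts y. t = x)"

text \<open>The successor is Zermelo's singleton. Emptiness is phrased with
  \<open>t \<noteq> t\<close>, a falsity built from an atomic formula.\<close>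

definition num_inductive :: "'l hset \<Rightarrow> bool" where
  "num_inductive w \<longleftrightarrow> (\<exists>z\<in>elts w. \<forall>t\<in>elts z. t \<noteq> t) \<and> (\<forall>x\<in>elts w. \<exists>y\<in>elts w. singleton_of y x)"

primrec num :: "nat \<Rightarrow> 'l hset" where
  "num 0 = HSet {}"
| "num (Suc n) = HSet {num n}"

definition nums :: "'l hset" where
  "nums = HSet (range num)"

lemma singleton_of_iff: "singleton_of y x \<longleftrightarrow> y = HSet {x}"
proof
  assume "singleton_of y x"
  then have "elts y = {x}" unfolding singleton_of_def by blast
  then show "y = HSet {x}" using HSet_elts[of y] by simp
qed (simp add: singleton_of_def)

lemma num_in_H: "num n \<in> H"
  by (induction n) (simp_all add: HSet_in_H countable_small)

lemma num_inj: "inj num"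
proof (rule injI)
  show "num m = num n \<Longrightarrow> m = n" for m n
  proof (induction m arbitrary: n)
    case 0
    then have "elts (num n) = {}" by (simp flip: 0)
    then show ?case by (cases n) simp_all
  next
    case (Suc m)
    then have "elts (num n) = {num m}" by (simp flip: Suc.prems)
    then show ?case using Suc.IH by (cases n) auto
  qed
qed

lemma elts_nums: "elts nums = range num"
  unfolding nums_def by (intro elts_HSet_small countable_small) simp

lemma nums_in_H: "nums \<in> H"
  unfolding nums_def by (intro HSet_in_H countable_small) (auto simp: num_in_H)

lemma num_inductiveD:
  assumes "num_inductive w"
  shows "num n \<in> elts w"
proof (induction n)
  case 0
  obtain z where z: "z \<in> elts w" "elts z = {}" using assms unfolding num_inductive_def by blast
  then show ?case using HSet_elts[of z] by simp
next
  case (Suc n)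
  then show ?case using assms unfolding num_inductive_def singleton_of_iff by auto
qed

lemma num_inductive_nums: "num_inductive nums"
proof -
  have "\<exists>z\<in>range num. \<forall>t\<in>elts z. t \<noteq> t" by (rule bexI[OF _ rangeI[of _ 0]]) simp
  moreover have "HSet {num n} \<in> range num" for n by (rule range_eqI[of _ _ "Suc n"]) simp
  ultimately show ?thesis unfolding num_inductive_def singleton_of_iff elts_nums by blast
qed

text \<open>\<open>nums\<close> is the least inductive set. Testing minimality inside
  \<open>H\<close> suffices, since \<open>nums\<close> itself belongs to \<open>H\<close>.\<close>

lemma nums_iff: "w = nums \<longleftrightarrow> num_inductive w \<and> (\<forall>v\<in>H. num_inductive v \<longrightarrow> (\<forall>x\<in>elts w. x \<in> elts v))"
proof
  assume "w = nums"
  then show "num_inductive w \<and> (\<forall>v\<in>H. num_inductive v \<longrightarrow> (\<forall>x\<in>elts w. x \<in> elts v))"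
    using num_inductive_nums num_inductiveD by (auto simp: elts_nums)
next
  assume w: "num_inductive w \<and> (\<forall>v\<in>H. num_inductive v \<longrightarrow> (\<forall>x\<in>elts w. x \<in> elts v))"
  then have "elts w \<subseteq> elts nums" using num_inductive_nums nums_in_H by blast
  moreover have "elts nums \<subseteq> elts w" using w num_inductiveD by (auto simp: elts_nums)
  ultimately show "w = nums" by (intro hset_ext) blast
qed

lemma definable_nums: "definable H (\<lambda>e. e i = nums)"
  unfolding nums_iff num_inductive_def singleton_of_def by (intro definable_intros)

text \<open>A multivalued \<open>h\<close> is allowed: selecting one value for each point gives an
  injection.\<close>

definition injects :: "'l hset \<Rightarrow> 'l hset \<Rightarrow> 'l hset \<Rightarrow> bool" where
  "injects h m w \<longleftrightarrow> (\<forall>x\<in>elts m. \<exists>k\<in>elts w. hpair x k \<in> elts h) \<and>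
    (\<forall>x\<in>elts m. \<forall>y\<in>elts m. \<forall>k\<in>elts w. hpair x k \<in> elts h \<longrightarrow> hpair y k \<in> elts h \<longrightarrow> x = y)"

text \<open>Closure under pairs allows nested arguments to be assembled inside \<open>m\<close>, so
  that \<open>g\<close> may be a function of one argument.\<close>

definition closed_under :: "'l hset \<Rightarrow> 'l hset \<Rightarrow> bool" where
  "closed_under m g \<longleftrightarrow> (\<forall>x\<in>elts m. \<forall>y\<in>elts m. \<exists>z\<in>elts m. z = hpair x y) \<and>
    (\<forall>x\<in>elts m. \<forall>q\<in>H. hpair x q \<in> elts g \<longrightarrow> q \<in> elts m)"

definition dense_code :: "'l hset \<Rightarrow> 'l hset \<Rightarrow> 'l hset \<Rightarrow> bool" where
  "dense_code P' R' d \<longleftrightarrow> (\<forall>x\<in>elts d. x \<in> elts P') \<and> (\<forall>p\<in>elts P'. \<exists>x\<in>elts d. hpair x p \<in> elts R')"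

definition generic_code :: "'l hset \<Rightarrow> 'l hset \<Rightarrow> 'l hset \<Rightarrow> 'l hset \<Rightarrow> bool" where
  "generic_code P' R' m S \<longleftrightarrow> (\<forall>x\<in>elts S. x \<in> elts m) \<and>
    (\<forall>x\<in>elts S. \<forall>y\<in>elts S. \<exists>z\<in>elts S. hpair z x \<in> elts R' \<and> hpair z y \<in> elts R') \<and>
    (\<forall>d\<in>elts m. dense_code P' R' d \<longrightarrow> (\<exists>x\<in>elts d. x \<in> elts S)) \<and>
    (\<exists>q\<in>elts P'. \<forall>x\<in>elts S. hpair q x \<in> elts R')"

text \<open>The first-order counterpart of \<open>generically_closing\<close>: \<open>g\<close> is a set of pairs, and countability is
  witnessed by an injection \<open>h\<close> into the Zermelo numerals \<open>w = nums\<close>.\<close>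

definition closure_code :: "'l hset \<Rightarrow> 'l hset \<Rightarrow> 'l hset \<Rightarrow> 'l hset \<Rightarrow> bool" where
  "closure_code g P' R' w \<longleftrightarrow>
    (\<forall>x\<in>H. \<forall>q\<in>H. \<forall>q'\<in>H. hpair x q \<in> elts g \<longrightarrow> hpair x q' \<in> elts g \<longrightarrow> q = q') \<and>
    (\<forall>m\<in>H. \<forall>h\<in>H. injects h m w \<longrightarrow> (\<forall>k\<in>elts w. k \<in> elts m) \<longrightarrow> closed_under m g \<longrightarrow>
      (\<forall>p\<in>elts P'. p \<in> elts m \<longrightarrow> (\<exists>S\<in>H. p \<in> elts S \<and> generic_code P' R' m S)))"

lemma definable_closure_code: "definable H (\<lambda>e. closure_code (e i) (e j) (e k) (e l))"
  unfolding closure_code_def injects_def closed_under_def generic_code_def dense_code_def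
  by (intro definable_intros)

section \<open>Reflection into a countable elementary submodel\<close>

context
  fixes N :: "'l hset set"
  assumes N: "countable N" "N \<prec> H"
begin

lemma N_subset: "N \<subseteq> H"
  using N(2) by (simp add: elementary_def)

lemma nums_in_N: "nums \<in> N"
proof -
  obtain a where a: "a \<in> N" using N(2) by (auto simp: elementary_def)
  have "definable H (\<lambda>e. e 0 = nums)" by (rule definable_nums)
  then have "\<exists>x\<in>N. x = nums"
    by (rule elementary_reflects[OF N(2), where R = "\<lambda>x a b c. x = nums", OF _ a a a])
      (use nums_in_H in blast)
  then show ?thesis by blast
qed

lemma num_in_N: "num n \<in> N"
proof (induction n)
  case 0
  have "\<exists>x\<in>N. \<forall>t\<in>elts x. t \<noteq> t"
  proof (rule elementary_reflects[OF N(2), where R = "\<lambda>x a b c. \<forall>t\<in>elts x. t \<noteq> t",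
        OF _ nums_in_N nums_in_N nums_in_N])
    show "definable H (\<lambda>e. \<forall>t\<in>elts (e 0). t \<noteq> t)" by (intro definable_intros)
    show "\<exists>x\<in>H. \<forall>t\<in>elts x. t \<noteq> t" using num_in_H[of 0] by (intro bexI[of _ "num 0"]) simp_all
  qed
  then obtain x where "x \<in> N" "elts x = {}" by blast
  then show ?case using HSet_elts[of x] by simp
next
  case (Suc n)
  have "\<exists>x\<in>N. singleton_of x (num n)"
  proof (rule elementary_reflects[OF N(2), where R = "\<lambda>x a b c. singleton_of x a", OF _ Suc Suc Suc])
    show "definable H (\<lambda>e. singleton_of (e 0) (e 1))"
      unfolding singleton_of_def by (intro definable_intros)
    show "\<exists>x\<in>H. singleton_of x (num n)"
      unfolding singleton_of_iff using num_in_H[of "Suc n"] by simp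
  qed
  then show ?case by (simp add: singleton_of_iff)
qed

lemma hpair_in_N:
  assumes "x \<in> N" "y \<in> N"
  shows "hpair x y \<in> N"
proof -
  have "\<exists>z\<in>N. z = hpair x y"
  proof (rule elementary_reflects[OF N(2), where R = "\<lambda>z a b c. z = hpair a b", OF _ assms assms(2)])
    show "definable H (\<lambda>e. e 0 = hpair (e 1) (e 2))" by (intro definable_intros)
    show "\<exists>z\<in>H. z = hpair x y" using hpair_in_H assms N_subset by blast
  qed
  then show ?thesis by blast
qed

lemma hpair_components_in_N:
  assumes "hpair x y \<in> N"
  shows "x \<in> N" "y \<in> N"
proof -
  have xy: "x \<in> H" "y \<in> H" using hpair_components_in_H assms N_subset by blast+
  have "\<exists>z\<in>N. \<exists>t\<in>H. hpair x y = hpair z t"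
  proof (rule elementary_reflects[OF N(2), where R = "\<lambda>z a b c. \<exists>t\<in>H. a = hpair z t",
        OF _ assms assms assms])
    show "definable H (\<lambda>e. \<exists>t\<in>H. e 1 = hpair (e 0) t)" by (intro definable_intros)
  qed (use xy in blast)
  then show "x \<in> N" by (auto simp: hpair_inject)
  have "\<exists>z\<in>N. \<exists>t\<in>H. hpair x y = hpair t z"
  proof (rule elementary_reflects[OF N(2), where R = "\<lambda>z a b c. \<exists>t\<in>H. a = hpair t z",
        OF _ assms assms assms])
    show "definable H (\<lambda>e. \<exists>t\<in>H. e 1 = hpair t (e 0))" by (intro definable_intros)
  qed (use xy in blast)
  then show "y \<in> N" by (auto simp: hpair_inject)
qed

text \<open>Some \<open>g\<close> with the closure property lies in \<open>N\<close>. Being a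
  countable subset of \<open>H\<close>, the set \<open>N\<close> is itself coded in
  \<open>H\<close>, so the property can be applied to \<open>m = HSet N\<close> once
  \<open>N\<close> is seen to contain the numerals and to be closed under pairs and
  \<open>g\<close>.\<close>

lemma generic_code_in_N:
  assumes PR: "P' \<in> N" "R' \<in> N" and ex: "\<exists>g\<in>H. closure_code g P' R' nums" and p: "p \<in> elts P'" "p \<in> N"
  shows "\<exists>S. p \<in> elts S \<and> generic_code P' R' (HSet N) S"
proof -
  have "\<exists>g\<in>N. closure_code g P' R' nums"
  proof (rule elementary_reflects[OF N(2), where R = closure_code, OF _ PR nums_in_N ex])
    show "definable H (\<lambda>e. closure_code (e 0) (e 1) (e 2) (e 3))" by (rule definable_closure_code)
  qed
  then obtain g where g: "g \<in> N" "closure_code g P' R' nums" by blast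
  have small: "|N| <o lam" by (rule countable_small[OF N(1)])
  have m: "HSet N \<in> H" "elts (HSet N) = N" using HSet_in_H[OF small N_subset] elts_HSet_small[OF small] by blast+
  define h where "h = (\<lambda>x. hpair x (num (to_nat_on N x))) ` N"
  have "|h| <o lam" unfolding h_def by (intro countable_small countable_image N(1))
  moreover have "h \<subseteq> H" using hpair_in_H num_in_H N_subset by (auto simp: h_def)
  ultimately have h: "HSet h \<in> H" "elts (HSet h) = h" using HSet_in_H elts_HSet_small by blast+
  have "injects (HSet h) (HSet N) nums" unfolding injects_def h(2) m(2)
  proof (intro conjI ballI impI)
    show "\<exists>k\<in>elts nums. hpair x k \<in> h" if "x \<in> N" for x
      using that by (auto simp: h_def elts_nums)
    show "x = y" if "x \<in> N" "y \<in> N" "hpair x k \<in> h" "hpair y k \<in> h" for x y k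
    proof -
      have "num (to_nat_on N x) = num (to_nat_on N y)" using that(3,4) by (auto simp: h_def hpair_inject)
      then show ?thesis using that(1,2) N(1) num_inj by (auto simp: inj_eq)
    qed
  qed
  moreover have "closed_under (HSet N) g" unfolding closed_under_def m(2)
  proof (intro conjI ballI impI)
    show "\<exists>z\<in>N. z = hpair x y" if "x \<in> N" "y \<in> N" for x y using hpair_in_N that by blast
    show "q \<in> N" if "x \<in> N" "q \<in> H" "hpair x q \<in> elts g" for x q
    proof -
      \<comment> \<open>Reflection yields only some value in \<open>N\<close>; single-valuedness of
        \<open>g\<close> identifies it with \<open>q\<close>.\<close>
      have "\<exists>q\<in>N. hpair x q \<in> elts g"
      proof (rule elementary_reflects[OF N(2), where R = "\<lambda>q g x c. hpair x q \<in> elts g",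
            OF _ g(1) that(1) that(1)])
        show "definable H (\<lambda>e. hpair (e 2) (e 0) \<in> elts (e 1))" by (intro definable_intros)
      qed (use that in blast)
      then obtain q' where q': "q' \<in> N" "hpair x q' \<in> elts g" by blast
      have "\<forall>x\<in>H. \<forall>q\<in>H. \<forall>q'\<in>H. hpair x q \<in> elts g \<longrightarrow> hpair x q' \<in> elts g \<longrightarrow> q = q'"
        using g(2) unfolding closure_code_def by (rule conjunct1)
      then have "q = q'" using that q' N_subset by blast
      then show ?thesis using q' by simp
    qed
  qed
  moreover have "\<forall>k\<in>elts nums. k \<in> elts (HSet N)" using num_in_N by (auto simp: elts_nums m(2))
  ultimately have "\<forall>p\<in>elts P'. p \<in> elts (HSet N) \<longrightarrow> (\<exists>S\<in>H. p \<in> elts S \<and> generic_code P' R' (HSet N) S)"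
    using g(2) m(1) h(1) unfolding closure_code_def by blast
  then show ?thesis using p m(2) by blast
qed

end

section \<open>Coding a closing function as an element of H(lambda)\<close>

text \<open>\<open>G\<close> becomes a set of pairs with nested arguments
  \<open>((p, D), k)\<close>. There are at most \<open>|Pow P|\<close> dense sets, so the bound on
  \<open>Pow P\<close> keeps this set in \<open>H\<close>.\<close>

lemma closure_code_exists:
  fixes G :: "'p \<Rightarrow> 'p set \<Rightarrow> nat \<Rightarrow> 'p"
  assumes G: "generically_closing P le G"
    and small: "|Pow P| <o lam" and inj: "inj_on c P" and P': "P' \<in> H" "elts P' = c ` P"
    and R': "elts R' = {hpair (c p) (c q) |p q. p \<in> P \<and> q \<in> P \<and> le p q}"
  shows "\<exists>g\<in>H. closure_code g P' R' nums"
proof -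
  have G_in: "\<And>p D k. p \<in> P \<Longrightarrow> dense_in P le D \<Longrightarrow> G p D k \<in> P"
    using G unfolding generically_closing_def by blast
  have small_P: "|P| <o lam" using card_of_Pow small ordLess_transitive by blast
  have c_H: "c p \<in> H" if "p \<in> P" for p using H_trans[OF P'(1)] P'(2) that by blast
  have R'_iff: "hpair (c p) (c q) \<in> elts R' \<longleftrightarrow> le p q" if "p \<in> P" "q \<in> P" for p q
    using that inj by (auto simp: R' hpair_inject inj_on_eq_iff)
  define code where "code D = HSet (c ` D)" for D
  have code: "code D \<in> H" "elts (code D) = c ` D" if "D \<subseteq> P" for D
  proof -
    have "|c ` D| <o lam"
      by (rule small_image, rule ordLeq_ordLess_trans[OF card_of_mono1[OF that] small_P])
    then show "code D \<in> H" "elts (code D) = c ` D"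
      unfolding code_def using c_H that by (auto intro!: HSet_in_H simp: elts_HSet_small)
  qed
  define arg where "arg p D k = hpair (hpair (c p) (code D)) (num k)" for p D k
  define g where "g = (\<lambda>(p, D, k). hpair (arg p D k) (c (G p D k))) ` (P \<times> {D. dense_in P le D} \<times> UNIV)"
  have dense_Pow: "{D. dense_in P le D} \<subseteq> Pow P" by (auto simp: dense_in_def)
  have small_dense: "|{D. dense_in P le D}| <o lam"
    by (rule ordLeq_ordLess_trans[OF card_of_mono1[OF dense_Pow] small])
  have "|g| <o lam" unfolding g_def
    by (rule small_image[OF small_Times[OF small_P small_Times[OF small_dense countable_small]]]) simp
  moreover have arg_H: "arg p D k \<in> H" if "p \<in> P" "dense_in P le D" for p D k
    unfolding arg_def using that by (intro hpair_in_H c_H code num_in_H) (auto simp: dense_in_def)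
  then have "g \<subseteq> H" using hpair_in_H c_H G_in by (auto simp: g_def)
  ultimately have g: "HSet g \<in> H" "elts (HSet g) = g" using HSet_in_H elts_HSet_small by blast+
  have arg_inject: "p = p' \<and> D = D' \<and> k = k'"
    if "arg p D k = arg p' D' k'" "p \<in> P" "p' \<in> P" "dense_in P le D" "dense_in P le D'" for p p' D D' k k'
  proof -
    have "c p = c p'" "code D = code D'" "num k = num k'" using that(1) by (simp_all add: arg_def hpair_inject)
    moreover from this(2) have "c ` D = c ` D'" using code(2) that(4,5) unfolding dense_in_def by metis
    ultimately show ?thesis using that(2-5) inj num_inj
      by (auto simp: inj_on_eq_iff inj_eq inj_on_image_eq_iff dense_in_def)
  qed
  have "closure_code (HSet g) P' R' nums" unfolding closure_code_def g(2)
  proof (intro conjI ballI impI)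
    show "q = q'" if xq: "hpair x q \<in> g" "hpair x q' \<in> g" for x q q'
    proof -
      obtain p D k where 1: "p \<in> P" "dense_in P le D" "x = arg p D k" "q = c (G p D k)"
        using xq(1) unfolding g_def by (auto simp: hpair_inject)
      obtain p' D' k' where 2: "p' \<in> P" "dense_in P le D'" "x = arg p' D' k'" "q' = c (G p' D' k')"
        using xq(2) unfolding g_def by (auto simp: hpair_inject)
      have "arg p D k = arg p' D' k'" using 1(3) 2(3) by simp
      from arg_inject[OF this 1(1) 2(1) 1(2) 2(2)] show ?thesis using 1(4) 2(4) by simp
    qed
    fix m h p assume m: "m \<in> H" and h: "injects h m nums" and nums: "\<forall>k\<in>elts nums. k \<in> elts m"
      and closed: "closed_under m (HSet g)" and p: "p \<in> elts P'" "p \<in> elts m"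
    have "\<forall>x\<in>elts m. \<exists>k\<in>elts nums. hpair x k \<in> elts h" using h unfolding injects_def by blast
    then obtain f where f: "\<And>x. x \<in> elts m \<Longrightarrow> f x \<in> elts nums \<and> hpair x (f x) \<in> elts h" by metis
    have "inj_on f (elts m)"
    proof (rule inj_onI)
      show "x = y" if "x \<in> elts m" "y \<in> elts m" "f x = f y" for x y
        using h f[OF that(1)] f[OF that(2)] that unfolding injects_def by metis
    qed
    moreover have "countable (f ` elts m)"
      by (rule countable_subset[of _ "range num"]) (use f elts_nums in auto)
    ultimately have count: "countable (elts m)" using countable_image_inj_on by blast
    \<comment> \<open>\<open>m\<close> is decoded into the conditions and the dense sets whose codes
      it contains; both families are countable because coding is injective.\<close>
    define M where "M = {q\<in>P. c q \<in> elts m}"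
    define \<D> where "\<D> = {D. dense_in P le D \<and> code D \<in> elts m}"
    have M: "countable M" "M \<subseteq> P"
    proof -
      show "M \<subseteq> P" by (auto simp: M_def)
      have "countable (c ` M)" by (rule countable_subset[OF _ count]) (auto simp: M_def)
      then show "countable M" by (rule countable_image_inj_on) (use inj \<open>M \<subseteq> P\<close> inj_on_subset in blast)
    qed
    have count_\<D>: "countable \<D>"
    proof (rule countable_image_inj_on)
      show "countable (code ` \<D>)" by (rule countable_subset[OF _ count]) (auto simp: \<D>_def)
      show "inj_on code \<D>"
      proof (rule inj_onI)
        fix D D' assume D: "D \<in> \<D>" "D' \<in> \<D>" "code D = code D'"
        then have "D \<subseteq> P" "D' \<subseteq> P" by (auto simp: \<D>_def dense_in_def)
        moreover from this have "c ` D = c ` D'" using code(2) D(3) by metis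
        ultimately show "D = D'" using inj by (simp add: inj_on_image_eq_iff)
      qed
    qed
    have G_closed: "G q D k \<in> M" if "q \<in> M" "D \<in> \<D>" for q D k
    proof -
      have q: "q \<in> P" "c q \<in> elts m" and D: "dense_in P le D" "code D \<in> elts m"
        using that by (auto simp: M_def \<D>_def)
      have pairs: "hpair x y \<in> elts m" if "x \<in> elts m" "y \<in> elts m" for x y
        using closed that unfolding closed_under_def by blast
      \<comment> \<open>The argument is built inside \<open>m\<close> from two codes and a numeral;
        this is why \<open>m\<close> is required to contain the numerals.\<close>
      have "arg q D k \<in> elts m"
        unfolding arg_def using nums by (intro pairs q D) (auto simp: elts_nums)
      moreover have "hpair (arg q D k) (c (G q D k)) \<in> g" using q D by (force simp: g_def)
      ultimately have "c (G q D k) \<in> elts m"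
        using closed c_H[OF G_in[OF q(1) D(1)]] unfolding closed_under_def g(2) by blast
      then show ?thesis using G_in[OF q(1) D(1)] by (simp add: M_def)
    qed
    obtain p0 where p0: "p = c p0" "p0 \<in> M" using p P'(2) by (auto simp: M_def)
    have "dense_in P le D \<and> (\<forall>p\<in>M. \<forall>k. G p D k \<in> M)" if "D \<in> \<D>" for D
      using G_closed[OF _ that] that by (simp add: \<D>_def)
    then obtain S where S: "p0 \<in> S" "strongly_generic P le M \<D> S"
      using conjunct2[OF G[unfolded generically_closing_def], rule_format, of M \<D> p0] M count_\<D> p0(2)
      by blast
    then have SM: "S \<subseteq> M" and dir: "\<And>x y. x \<in> S \<Longrightarrow> y \<in> S \<Longrightarrow> \<exists>z\<in>S. le z x \<and> le z y"
      and meets: "\<And>D. D \<in> \<D> \<Longrightarrow> S \<inter> D \<noteq> {}" and bound: "\<exists>q\<in>P. \<forall>x\<in>S. le q x"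
      by (auto simp: strongly_generic_def)
    have SP: "S \<subseteq> P" using SM M by blast
    have "generic_code P' R' m (code S)" unfolding generic_code_def code(2)[OF SP]
    proof (intro conjI ballI impI)
      show "x \<in> elts m" if "x \<in> c ` S" for x using that SM by (auto simp: M_def)
      show "\<exists>z\<in>c ` S. hpair z x \<in> elts R' \<and> hpair z y \<in> elts R'" if xy: "x \<in> c ` S" "y \<in> c ` S" for x y
      proof -
        obtain a b where ab: "x = c a" "y = c b" "a \<in> S" "b \<in> S" using xy by blast
        obtain z where "z \<in> S" "le z a" "le z b" using dir ab by blast
        then show ?thesis using R'_iff ab SP by blast
      qed
      show "\<exists>x\<in>elts d. x \<in> c ` S" if d: "d \<in> elts m" "dense_code P' R' d" for d
      proof -
        \<comment> \<open>An element \<open>d\<close> of \<open>m\<close> that is dense in the coded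
          sense is the code of a genuine dense set, hence of a member of
          \<open>\<D>\<close>.\<close>
        define D where "D = {q\<in>P. c q \<in> elts d}"
        have cD: "elts d = c ` D" using d(2) P'(2) by (auto simp: dense_code_def D_def)
        have "dense_in P le D" unfolding dense_in_def
        proof (intro conjI ballI)
          show "D \<subseteq> P" by (auto simp: D_def)
          fix q assume "q \<in> P"
          then obtain x where x: "x \<in> elts d" "hpair x (c q) \<in> elts R'"
            using d(2) P'(2) by (auto simp: dense_code_def)
          then obtain r where r: "r \<in> D" "x = c r" unfolding cD by (elim imageE)
          then have "le r q" using R'_iff[of r q] x(2) \<open>q \<in> P\<close> by (simp add: D_def)
          then show "\<exists>x\<in>D. le x q" using r(1) by blast
        qed
        moreover have "code D = d" unfolding code_def cD[symmetric] by (rule HSet_elts)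
        ultimately have "D \<in> \<D>" using d(1) by (simp add: \<D>_def)
        then show ?thesis using meets cD by blast
      qed
      show "\<exists>q\<in>elts P'. \<forall>x\<in>c ` S. hpair q x \<in> elts R'"
      proof -
        obtain q where q: "q \<in> P" "\<forall>x\<in>S. le q x" using bound by blast
        have "hpair (c q) (c x) \<in> elts R'" if "x \<in> S" for x
          using q R'_iff[of q x] that SP by blast
        then show ?thesis using q(1) P'(2) by blast
      qed
    qed
    moreover have "p \<in> elts (code S)" using S(1) p0(1) code(2)[OF SP] by blast
    ultimately show "\<exists>S\<in>H. p \<in> elts S \<and> generic_code P' R' m S" using code(1)[OF SP] by blast
  qed
  then show ?thesis using g(1) by blast
qed

end

section \<open>From the generic set to a descending sequence\<close>

text \<open>The set \<open>S'\<close> obtained by reflection decodes to a directed set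
  \<open>S\<close> of conditions with codes in \<open>N\<close> and a common lower bound. Extending
  within \<open>S\<close> through the countably many dense open sets coded in \<open>N\<close>
  produces the sequence.\<close>

lemma totally_properI:
  fixes G :: "'p \<Rightarrow> 'p set \<Rightarrow> nat \<Rightarrow> 'p"
  assumes G: "generically_closing P le G"
  shows "totally_proper TYPE('l) P le"
  unfolding totally_proper_def
proof (intro allI impI ballI)
  fix lam :: "'l rel" and N and c :: "'p \<Rightarrow> 'l hset" and p
  assume lam: "uncountable_regular lam" and small: "|Pow P| <o lam" and N: "countable N" "N \<prec> H_of lam"
    and model: "in_model c P le N" and p: "p \<in> P" "c p \<in> N"
  interpret hereditary_universe lam by standard (rule lam)
  obtain P' R' where inj: "inj_on c P" and P': "elts P' = c ` P"
    and R': "elts R' = {hpair (c p) (c q) |p q. p \<in> P \<and> q \<in> P \<and> le p q}" and PR: "hpair P' R' \<in> N"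
    using model unfolding in_model_def by blast
  note PRN = hpair_components_in_N[OF N PR]
  have R'_iff: "hpair (c p) (c q) \<in> elts R' \<longleftrightarrow> le p q" if "p \<in> P" "q \<in> P" for p q
    using that inj by (auto simp: R' hpair_inject inj_on_eq_iff)
  have elts_N: "elts (HSet N) = N" by (rule elts_HSet_small[OF countable_small[OF N(1)]])
  have "P' \<in> H" using PRN(1) N_subset[OF N] by blast
  from closure_code_exists[OF G small inj this P' R']
  have "\<exists>g\<in>H. closure_code g P' R' nums" .
  from generic_code_in_N[OF N PRN this] p P' obtain S' where S': "c p \<in> elts S'" "generic_code P' R' (HSet N) S'"
    by blast
  define S where "S = {q\<in>P. c q \<in> elts S'}"
  have pS: "p \<in> S" using p S' by (simp add: S_def)
  have SN: "c q \<in> N" if "q \<in> S" for q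
    using that S'(2) elts_N by (auto simp: generic_code_def S_def)
  have dir: "\<exists>z\<in>S. le z x \<and> le z y" if xy: "x \<in> S" "y \<in> S" for x y
  proof -
    obtain z' where z': "z' \<in> elts S'" "hpair z' (c x) \<in> elts R'" "hpair z' (c y) \<in> elts R'"
      using S'(2) xy unfolding generic_code_def S_def by blast
    then obtain z where "z \<in> P" "z' = c z" by (auto simp: R' hpair_inject)
    then show ?thesis using z' R'_iff xy by (auto simp: S_def)
  qed
  define \<D> where "\<D> = {D. dense_open P le D \<and> (\<exists>d\<in>N. elts d = c ` D)}"
  have "\<D> \<subseteq> (\<lambda>d. {q\<in>P. c q \<in> elts d}) ` N"
  proof
    fix D assume "D \<in> \<D>"
    then obtain d where d: "d \<in> N" "elts d = c ` D" "D \<subseteq> P" by (auto simp: \<D>_def dense_open_def)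
    then have "D = {q\<in>P. c q \<in> elts d}" using inj by (auto dest: inj_onD)
    then show "D \<in> (\<lambda>d. {q\<in>P. c q \<in> elts d}) ` N" using d(1) by blast
  qed
  then have "countable \<D>" by (rule countable_subset) (intro countable_image N(1))
  \<comment> \<open>\<open>UNIV\<close> makes the enumerated family nonempty, and every condition
    meets it.\<close>
  then have \<D>: "countable (insert UNIV \<D>)" by simp
  have extend: "\<exists>y\<in>S. le y x \<and> y \<in> E" if x: "x \<in> S" and E: "E \<in> insert UNIV \<D>" for x E
  proof (cases "E = UNIV")
    case True
    then show ?thesis using dir[OF x x] by blast
  next
    case False
    then obtain d where D: "dense_open P le E" and d: "d \<in> N" "elts d = c ` E" using E by (auto simp: \<D>_def)
    have EP: "E \<subseteq> P" using D by (simp add: dense_open_def)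
    have "dense_code P' R' d" unfolding dense_code_def d(2) P'
      using D R'_iff EP unfolding dense_open_def by blast
    then obtain y' where "y' \<in> elts d" "y' \<in> elts S'"
      using S'(2) d(1) elts_N unfolding generic_code_def by blast
    then obtain y where y: "y \<in> E" "y \<in> S" using d(2) EP by (auto simp: S_def)
    \<comment> \<open>A common extension of \<open>x\<close> and of some \<open>y \<in> E\<close>
      stays in \<open>E\<close> because \<open>E\<close> is open.\<close>
    obtain z where z: "z \<in> S" "le z x" "le z y" using dir[OF x y(2)] by blast
    then have "z \<in> E" using D y(1) unfolding dense_open_def S_def by blast
    then show ?thesis using z by blast
  qed
  have "from_nat_into (insert UNIV \<D>) i \<in> insert UNIV \<D>" for i by (rule from_nat_into) simp
  then obtain s where s: "s 0 = p" "\<And>n. s n \<in> S" "\<And>n. le (s (Suc n)) (s n)"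
    "\<And>i m. \<exists>n\<ge>m. s n \<in> from_nat_into (insert UNIV \<D>) i"
    using generic_sequence[OF pS, of le "from_nat_into (insert UNIV \<D>)"] extend by metis
  have "\<exists>n. s n \<in> D" if "D \<in> \<D>" for D
    using s(4)[of 0 "to_nat_on (insert UNIV \<D>) D"] from_nat_into_to_nat_on[OF \<D>, of D] that by auto
  moreover obtain q' where q': "q' \<in> elts P'" "\<forall>x\<in>elts S'. hpair q' x \<in> elts R'"
    using S'(2) unfolding generic_code_def by blast
  then obtain q where "q \<in> P" "q' = c q" using P' by blast
  then have "\<forall>n. le q (s n)" using q' s(2) R'_iff by (auto simp: S_def)
  moreover have "s n \<in> P \<and> c (s n) \<in> N \<and> le (s (Suc n)) (s n)" for n
    using s(2)[of n] SN s(3) by (simp add: S_def)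
  ultimately show "\<exists>s. s 0 = p \<and> (\<forall>n. s n \<in> P \<and> c (s n) \<in> N \<and> le (s (Suc n)) (s n)) \<and>
      (\<forall>D d. dense_open P le D \<and> elts d = c ` D \<and> d \<in> N \<longrightarrow> (\<exists>n. s n \<in> D)) \<and>
      (\<exists>q\<in>P. \<forall>n. le q (s n))"
    using s(1) \<open>q \<in> P\<close> by (intro exI[of _ s]) (auto simp: \<D>_def)
qed

theorem theorem2:
  fixes kap :: "'k rel"
    and I :: "'k \<Rightarrow> omega1 set set"
    and A :: "'k \<Rightarrow> omega1 \<Rightarrow> omega1 set"
  assumes "CH"
    and "Card_order kap"
    and "\<And>\<xi>. \<xi> \<in> Field kap \<Longrightarrow> P_ideal (I \<xi>)"
    and "\<And>\<xi>. \<xi> \<in> Field kap \<Longrightarrow> generating_sequence (A \<xi>) (I \<xi>)"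
  shows "totally_proper TYPE('l) (P_forcing kap I) (P_le A)"
proof -
  interpret P_ideal_sequence kap I A by standard (use assms in blast)+
  show ?thesis using generically_closing_exists totally_properI by blast
qed

end
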